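(* Fix an even integer $m\ge2$. Let $q=q(d)$ be a positive integer with $q<(\log d)/(m+2)$, let $e$ be an edge of $T_{m,d}$, and let $f$ be chosen uniformly at random from $\mathrm{Hom}(T_{m,d},K_q)$. Then, for all sufficiently large $d$, $$\Pr(e\text{ is not ideal with respect to }f)\le d^{-4}.$$
   Context: For $d\ge1$ and even $m\ge 2$, the even discrete torus $T_{m,d}$ is the graph with vertex set $\{0,1,\dots,m-1\}^d$ in which two strings are adjacent iff they differ by exactly $1$ (mod $m$) in exactly one coordinate and agree in all others; $\mathcal{E}$ and $\mathcal{O}$ are the sets of strings with even and odd coordinate sum, and $N_x$ is the neighborhood of $x$. $K_q$ is the complete loopless graph on $\{1,\dots,q\}$, so $\mathrm{Hom}(T_{m,d},K_q)$ is the set of proper $q$-colorings of $T_{m,d}$. For $A,B\subseteq V(K_q)$, $A\sim B$ means every vertex of $A$ is adjacent to every vertex of $B$; $\eta(K_q)=\max\{|A||B|:A\sim B\}$ and $\mathcal{M}(K_q)=\{(A,B):A\sim B,|A||B|=\eta(K_q)\}$. An edge $uv$ with $u\in\mathcal{E}$ is ideal with respect to $f$ if $f(N_u)=B$ and $f(N_v)=A$ for some $(A,B)\in\mathcal{M}(K_q)$. Here $\log=\log_2$. *)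

theory Defs
  imports "HOL-Probability.Probability"
begin

text \<open>Graphs are given by a vertex set and an adjacency predicate, which is only consulted on
  vertices.  Loops are possible in general.\<close>

record 'a graph =
  verts :: "'a set"
  adj :: "'a \<Rightarrow> 'a \<Rightarrow> bool"

definition edges :: "'a graph \<Rightarrow> 'a set set" where
  "edges G = {{u, v} | u v. u \<in> verts G \<and> v \<in> verts G \<and> adj G u v}"

definition nbhd :: "'a graph \<Rightarrow> 'a \<Rightarrow> 'a set" where
  "nbhd G x = {y \<in> verts G. adj G x y}"

text \<open>Homomorphisms are extensional, so that each one is represented by exactly one HOL function.\<close>

definition Hom :: "'a graph \<Rightarrow> 'b graph \<Rightarrow> ('a \<Rightarrow> 'b) set" where
  "Hom G H = {f \<in> verts G \<rightarrow>\<^sub>E verts H.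
     \<forall>u\<in>verts G. \<forall>v\<in>verts G. adj G u v \<longrightarrow> adj H (f u) (f v)}"

definition fully_adj :: "'b graph \<Rightarrow> 'b set \<Rightarrow> 'b set \<Rightarrow> bool" where
  "fully_adj H A B \<longleftrightarrow> A \<subseteq> verts H \<and> B \<subseteq> verts H \<and> (\<forall>a\<in>A. \<forall>b\<in>B. adj H a b)"

definition eta :: "'b graph \<Rightarrow> nat" where
  "eta H = Max {card A * card B | A B. fully_adj H A B}"

definition max_pairs :: "'b graph \<Rightarrow> ('b set \<times> 'b set) set" where
  "max_pairs H = {(A, B). fully_adj H A B \<and> card A * card B = eta H}"

definition torus :: "nat \<Rightarrow> nat \<Rightarrow> nat list graph" where
  "torus m d =
     \<lparr> verts = {x. length x = d \<and> set x \<subseteq> {0..<m}},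
       adj = (\<lambda>x y. \<exists>i<d. (x ! i = (y ! i + 1) mod m \<or> y ! i = (x ! i + 1) mod m) \<and>
                        (\<forall>j<d. j \<noteq> i \<longrightarrow> x ! j = y ! j)) \<rparr>"

definition even_verts :: "nat \<Rightarrow> nat \<Rightarrow> nat list set" where
  "even_verts m d = {x \<in> verts (torus m d). even (sum_list x)}"

definition complete_loopless_graph :: "nat \<Rightarrow> nat graph" where
  "complete_loopless_graph q = \<lparr> verts = {1..q}, adj = (\<lambda>a b. a \<noteq> b) \<rparr>"

text \<open>For even \<open>m\<close> every edge of the torus has exactly one even endpoint, so \<open>u\<close> and \<open>v\<close> below are
  determined by the edge \<open>e\<close>.\<close>

definition ideal_edge ::
  "nat \<Rightarrow> nat \<Rightarrow> 'b graph \<Rightarrow> (nat list \<Rightarrow> 'b) \<Rightarrow> nat list set \<Rightarrow> bool" where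
  "ideal_edge m d H f e \<longleftrightarrow>
     (\<exists>u v. e = {u, v} \<and> u \<in> even_verts m d \<and>
        (\<exists>(A, B) \<in> max_pairs H.
           f ` nbhd (torus m d) u = B \<and> f ` nbhd (torus m d) v = A))"

end

theory Submission
  imports Defs "HOL-Real_Asymp.Real_Asymp"
begin

text \<open>
  Let \<open>f\<close> be a uniform proper colouring, write \<open>C\<^sub>x = f(N\<^sub>x)\<close>, and let the level of a vertex be its coordinate
  sum. There are at least \<open>\<eta>\<close> to the power \<open>|V|/2\<close> colourings; two upper bounds for the entropy of \<open>f\<close>
  are played against this.

  \<^item> A conditional Shearer inequality, with the neighbourhood of \<open>v\<close> revealed given everything far below \<open>v\<close>.
    Call \<open>v\<close> bad if some colour of \<open>C\<^sub>v\<close> is missing from the lower or from the upper neighbours of \<open>v\<close>, or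
    if \<open>|C\<^sub>v| (q - |C\<^sub>v|) < \<eta>\<close>. If \<open>v\<close> has \<open>s \<approx> \<surd>d\<close> neighbours of either kind, being bad costs \<open>s/q\<close> bits, while the price of naming
    \<open>C\<^sub>v\<close> is paid only if \<open>C\<^sub>v\<close> differs from \<open>C\<close> at a vertex \<open>2m\<close> levels below, hence only if one of
    \<open>2m\<close> edges is not ideal.
  \<^item> The chain rule along the levels, which bounds the entropy by the expectation of the sum of
    \<open>log (q - |f(lower neighbours of x)|)\<close>. If neither end of \<open>xy\<close> is bad and \<open>C\<^sub>x \<union> C\<^sub>y\<close> is everything,
    then \<open>(q - |C\<^sub>x|) (q - |C\<^sub>y|) \<le> \<eta>\<close> with equality only for ideal edges. As a colour missing from
    \<open>C\<^sub>x \<union> C\<^sub>y\<close> can be turned into a bad vertex by recolouring \<open>y\<close>, non-ideal edges are at most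
    polynomially in \<open>q\<close> more likely than bad vertices.

  By edge transitivity both bounds concern the same probability, and together they force it to be
  smaller than every power of \<open>1/d\<close>.
\<close>

section \<open>Entropy of restrictions of a uniformly random function\<close>

definition agree :: "('a \<Rightarrow> 'b) set \<Rightarrow> 'a set \<Rightarrow> ('a \<Rightarrow> 'b) \<Rightarrow> ('a \<Rightarrow> 'b) set" where
  "agree F S f = {g \<in> F. \<forall>x\<in>S. g x = f x}"

text \<open>This is \<open>card F\<close> times the Shannon entropy (in bits) of \<open>f|S\<close> for uniform \<open>f \<in> F\<close>.\<close>

definition ent :: "('a \<Rightarrow> 'b) set \<Rightarrow> 'a set \<Rightarrow> real" where
  "ent F S = (\<Sum>f\<in>F. log 2 (real (card F) / real (card (agree F S f))))"

lemma finite_agree: "finite F \<Longrightarrow> finite (agree F S f)"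
  by (simp add: agree_def)

lemma self_in_agree: "f \<in> F \<Longrightarrow> f \<in> agree F S f"
  by (simp add: agree_def)

lemma card_agree_pos: "finite F \<Longrightarrow> f \<in> F \<Longrightarrow> 0 < card (agree F S f)"
  using self_in_agree finite_agree by (metis card_gt_0_iff empty_iff)

lemma agree_cong: "g \<in> agree F T f \<Longrightarrow> S \<subseteq> T \<Longrightarrow> agree F S g = agree F S f"
  by (auto simp: agree_def subset_iff)

lemma agree_sym: "f \<in> F \<Longrightarrow> g \<in> F \<Longrightarrow> f \<in> agree F S g \<longleftrightarrow> g \<in> agree F S f"
  by (auto simp: agree_def)

lemma ent_empty: "finite F \<Longrightarrow> ent F {} = 0"
  by (cases "F = {}") (auto simp: ent_def agree_def card_gt_0_iff)

text \<open>For \<open>T \<subseteq> U\<close> this is \<open>card F\<close> times the conditional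
  entropy of \<open>f\<close> on \<open>U\<close> given \<open>f\<close> on \<open>T\<close>, as an
  average over \<open>f\<close>.\<close>

lemma ent_diff:
  assumes "finite F"
  shows "ent F U - ent F T =
    (\<Sum>f\<in>F. log 2 (real (card (agree F T f)) / real (card (agree F U f))))"
proof -
  have "log 2 (real (card F) / real (card (agree F U f))) - log 2 (real (card F) / real (card (agree F T f)))
      = log 2 (real (card (agree F T f)) / real (card (agree F U f)))" if "f \<in> F" for f
  proof -
    have "0 < card F" using that assms by (metis card_gt_0_iff empty_iff)
    then show ?thesis
      using card_agree_pos[OF assms that, of U] card_agree_pos[OF assms that, of T]
      by (simp add: log_divide)
  qed
  then show ?thesis
    by (simp add: ent_def flip: sum_subtractf)
qed

text \<open>Gibbs' inequality. \<open>K f\<close> plays the role of a guessed conditional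
  probability of \<open>f\<close> on \<open>U\<close> given \<open>f\<close> on \<open>T\<close>,
  and the last assumption says that the guesses have total mass at most one on each
  \<open>T\<close>-class. The cost of coding by a guess is at least the entropy, by
  \<open>ln x \<le> x - 1\<close>.\<close>

lemma ent_diff_le_kernel:
  assumes fin: "finite F" and pos: "\<And>f. f \<in> F \<Longrightarrow> K f > 0"
    and kernel: "\<And>f. f \<in> F \<Longrightarrow> (\<Sum>g\<in>agree F T f. K g / real (card (agree F U g))) \<le> 1"
  shows "ent F U - ent F T \<le> (\<Sum>f\<in>F. - log 2 (K f))"
proof -
  define a where "a f = K f / real (card (agree F U f))" for f
  have pw: "log 2 (real (card (agree F T f)) / real (card (agree F U f))) + log 2 (K f)
      \<le> (real (card (agree F T f)) * a f - 1) / ln 2" if "f \<in> F" for f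
  proof -
    have "log 2 (real (card (agree F T f)) / real (card (agree F U f))) + log 2 (K f)
       = log 2 (real (card (agree F T f)) * a f)"
      using card_agree_pos[OF fin that, of U] card_agree_pos[OF fin that, of T] pos[OF that]
      by (simp add: a_def log_mult log_divide)
    also have "\<dots> \<le> (real (card (agree F T f)) * a f - 1) / ln 2"
      unfolding log_def
      using card_agree_pos[OF fin that, of U] card_agree_pos[OF fin that, of T] pos[OF that]
      by (intro divide_right_mono ln_le_minus_one) (auto simp: a_def)
    finally show ?thesis .
  qed
  \<comment> \<open>Double counting of the pairs that agree on \<open>T\<close>: agreement is
    symmetric, so \<open>a\<close> may be summed over the class of the other member, where
    \<open>kernel\<close> applies.\<close>
  have "(\<Sum>f\<in>F. real (card (agree F T f)) * a f) = (\<Sum>f\<in>F. \<Sum>g\<in>agree F T f. a f)"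
    by simp
  also have "\<dots> = (\<Sum>f\<in>F. \<Sum>g\<in>F. if g \<in> agree F T f then a f else 0)"
    using fin by (intro sum.cong refl sum.mono_neutral_cong_left) (auto simp: agree_def)
  also have "\<dots> = (\<Sum>g\<in>F. \<Sum>f\<in>F. if f \<in> agree F T g then a f else 0)"
    by (subst sum.swap) (auto intro!: sum.cong simp: agree_sym)
  also have "\<dots> = (\<Sum>g\<in>F. \<Sum>f\<in>agree F T g. a f)"
    using fin by (intro sum.cong refl sum.mono_neutral_cong_right) (auto simp: agree_def)
  also have "\<dots> \<le> (\<Sum>g\<in>F. 1)"
    using kernel by (intro sum_mono) (simp add: a_def)
  finally have *: "(\<Sum>f\<in>F. real (card (agree F T f)) * a f - 1) \<le> 0"
    by (simp add: sum_subtractf)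
  have "ent F U - ent F T + (\<Sum>f\<in>F. log 2 (K f))
      \<le> (\<Sum>f\<in>F. (real (card (agree F T f)) * a f - 1) / ln 2)"
    unfolding ent_diff[OF fin] sum.distrib[symmetric] by (intro sum_mono pw)
  also have "\<dots> = (\<Sum>f\<in>F. real (card (agree F T f)) * a f - 1) / ln 2"
    by (simp add: sum_divide_distrib)
  also have "\<dots> \<le> 0"
    using * by (simp add: divide_nonpos_pos)
  finally show ?thesis by (simp add: sum_negf)
qed

text \<open>Dividing by the size of the fibre makes every value of \<open>k\<close> count
  once.\<close>

lemma sum_div_card_fibre:
  fixes \<phi> :: "'k \<Rightarrow> real"
  assumes "finite A"
  shows "(\<Sum>g\<in>A. \<phi> (k g) / real (card {g'\<in>A. k g' = k g})) = (\<Sum>x\<in>k ` A. \<phi> x)"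
proof -
  have "(\<Sum>g\<in>A. \<phi> (k g) / real (card {g'\<in>A. k g' = k g}))
      = (\<Sum>x\<in>k ` A. \<Sum>g | g \<in> A \<and> k g = x. \<phi> (k g) / real (card {g'\<in>A. k g' = k g}))"
    using assms by (rule sum.image_gen)
  also have "\<dots> = (\<Sum>x\<in>k ` A. \<phi> x)"
  proof (intro sum.cong refl)
    fix x assume "x \<in> k ` A"
    then have "card {g'\<in>A. k g' = x} > 0" using assms by (auto simp: card_gt_0_iff)
    then show "(\<Sum>g | g \<in> A \<and> k g = x. \<phi> (k g) / real (card {g'\<in>A. k g' = k g})) = \<phi> x"
      by simp
  qed
  finally show ?thesis .
qed

lemma restrict_eq_iff: "restrict g S = restrict f S \<longleftrightarrow> (\<forall>x\<in>S. g x = f x)"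
  by (auto simp: restrict_def fun_eq_iff)

text \<open>Turns the mass condition of \<open>ent_diff_le_kernel\<close> into a sum over the
  possible patterns on \<open>S\<close> once the values on \<open>T\<close> are fixed.\<close>

lemma sum_agree_div_card:
  fixes \<phi> :: "('a \<Rightarrow> 'b) \<Rightarrow> real"
  assumes "finite F"
  shows "(\<Sum>g\<in>agree F T f. \<phi> (restrict g S) / real (card (agree F (S \<union> T) g)))
     = (\<Sum>x\<in>(\<lambda>g. restrict g S) ` agree F T f. \<phi> x)"
proof -
  have "agree F (S \<union> T) g = {g' \<in> agree F T f. restrict g' S = restrict g S}" if "g \<in> agree F T f" for g
    using that unfolding agree_def restrict_eq_iff by auto
  then show ?thesis
    using sum_div_card_fibre[OF finite_agree[OF assms], of \<phi> "\<lambda>g. restrict g S" T f] by simp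
qed

section \<open>Submodularity, chain rule and Shearer's inequality\<close>

text \<open>Conditioning on more lowers the entropy: the true conditional law of \<open>f\<close> on
  \<open>S\<close> given \<open>T'\<close>, which is \<open>?K\<close>, remains an admissible guess
  when the larger set \<open>T\<close> is known.\<close>

lemma ent_submodular:
  assumes fin: "finite F" and sub: "T' \<subseteq> T"
  shows "ent F (S \<union> T) - ent F T \<le> ent F (S \<union> T') - ent F T'"
proof -
  let ?K = "\<lambda>f. real (card (agree F (S \<union> T') f)) / real (card (agree F T' f))"
  have "ent F (S \<union> T) - ent F T \<le> (\<Sum>f\<in>F. - log 2 (?K f))"
  proof (rule ent_diff_le_kernel[OF fin])
    fix f assume f: "f \<in> F"
    show "?K f > 0" using card_agree_pos[OF fin f] by simp
    let ?\<phi> = "\<lambda>x. real (card {g\<in>agree F T' f. restrict g S = x})"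
    have "(\<Sum>g\<in>agree F T f. ?K g / real (card (agree F (S \<union> T) g)))
       = (\<Sum>g\<in>agree F T f. ?\<phi> (restrict g S) / real (card (agree F (S \<union> T) g))) / real (card (agree F T' f))"
      unfolding sum_divide_distrib
    proof (intro sum.cong refl)
      fix g assume g: "g \<in> agree F T f"
      have "agree F (S \<union> T') g = {g' \<in> agree F T' f. restrict g' S = restrict g S}"
        using g sub unfolding agree_def restrict_eq_iff by auto
      then show "?K g / real (card (agree F (S \<union> T) g)) =
          ?\<phi> (restrict g S) / real (card (agree F (S \<union> T) g)) / real (card (agree F T' f))"
        using agree_cong[OF g sub] by simp
    qed
    also have "\<dots> = (\<Sum>x\<in>(\<lambda>g. restrict g S) ` agree F T f. ?\<phi> x) / real (card (agree F T' f))"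
      by (subst sum_agree_div_card[OF fin, where \<phi> = ?\<phi>]) simp
    also have "\<dots> \<le> (\<Sum>x\<in>(\<lambda>g. restrict g S) ` agree F T' f. ?\<phi> x) / real (card (agree F T' f))"
      using sub fin by (intro divide_right_mono sum_mono2) (auto simp: agree_def)
    also have "(\<Sum>x\<in>(\<lambda>g. restrict g S) ` agree F T' f. ?\<phi> x) = real (card (agree F T' f))"
      using sum.image_gen[OF finite_agree[OF fin], of "\<lambda>_. 1::real" T' f "\<lambda>g. restrict g S"] by simp
    finally show "(\<Sum>g\<in>agree F T f. ?K g / real (card (agree F (S \<union> T) g))) \<le> 1"
      using card_agree_pos[OF fin f, of T'] by (simp split: if_splits)
  qed
  also have "\<dots> = ent F (S \<union> T') - ent F T'"
    unfolding ent_diff[OF fin]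
  proof (intro sum.cong refl)
    fix f assume f: "f \<in> F"
    show "- log 2 (?K f) = log 2 (real (card (agree F T' f)) / real (card (agree F (S \<union> T') f)))"
      using card_agree_pos[OF fin f, of T'] card_agree_pos[OF fin f, of "S \<union> T'"] by (simp add: log_divide)
  qed
  finally show ?thesis .
qed

text \<open>The chain rule, for an arbitrary set function, with the elements of \<open>S\<close>
  added in the order of \<open>\<kappa>\<close>.\<close>

lemma telescope_ranked:
  fixes h :: "'a set \<Rightarrow> real" and \<kappa> :: "'a \<Rightarrow> nat"
  assumes "finite S" "inj_on \<kappa> S"
  shows "h (S \<union> T) - h T =
    (\<Sum>u\<in>S. h (insert u ({w\<in>S. \<kappa> w < \<kappa> u} \<union> T)) - h ({w\<in>S. \<kappa> w < \<kappa> u} \<union> T))"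
  using assms
proof (induction S rule: finite_ranking_induct[where f = \<kappa>])
  case empty
  then show ?case by simp
next
  case (insert x S)
  show ?case
  proof (cases "x \<in> S")
    case True
    then show ?thesis using insert by (simp add: insert_absorb)
  next
    case False
    \<comment> \<open>The induction adds an element of largest rank, so the initial segments of the
      earlier elements do not change.\<close>
    have lt: "\<kappa> w < \<kappa> x" if "w \<in> S" for w
      using insert.hyps(2)[OF that] insert.prems False that by (metis inj_on_contraD insertCI le_neq_implies_less)
    have "{w \<in> insert x S. \<kappa> w < \<kappa> x} = S" using lt by auto
    moreover have "{w \<in> insert x S. \<kappa> w < \<kappa> u} = {w\<in>S. \<kappa> w < \<kappa> u}" if "u \<in> S" for u
      using lt[OF that] by auto
    moreover have "inj_on \<kappa> S" using insert.prems by (simp add: inj_on_def)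
    ultimately show ?thesis
      using insert.IH False insert.hyps(1) by simp
  qed
qed

text \<open>A conditional Shearer inequality. When \<open>N v\<close> is revealed by increasing rank
  on top of \<open>T v\<close>, all that is known before \<open>u\<close> has lower rank than
  \<open>u\<close>; by submodularity the increment at \<open>u\<close> is at least its increment
  \<open>\<delta> u\<close> in the chain rule for \<open>Y\<close>. Each \<open>u\<close> is met
  \<open>r\<close> times.\<close>

lemma shearer_ranked:
  fixes \<kappa> :: "'a \<Rightarrow> nat" and N T :: "'i \<Rightarrow> 'a set"
  assumes fin: "finite F" "finite Y" "finite I" and inj: "inj_on \<kappa> Y"
    and sub: "\<And>v. v \<in> I \<Longrightarrow> N v \<subseteq> Y" "\<And>v. v \<in> I \<Longrightarrow> T v \<subseteq> Y"
    and below: "\<And>v w u. v \<in> I \<Longrightarrow> w \<in> T v \<Longrightarrow> u \<in> N v \<Longrightarrow> \<kappa> w < \<kappa> u"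
    and cover: "\<And>u. u \<in> Y \<Longrightarrow> card {v\<in>I. u \<in> N v} = r"
  shows "real r * ent F Y \<le> (\<Sum>v\<in>I. ent F (N v \<union> T v) - ent F (T v))"
proof -
  define \<delta> where "\<delta> u = ent F (insert u {w\<in>Y. \<kappa> w < \<kappa> u}) - ent F {w\<in>Y. \<kappa> w < \<kappa> u}" for u
  have ge: "ent F (N v \<union> T v) - ent F (T v) \<ge> (\<Sum>u\<in>N v. \<delta> u)" if v: "v \<in> I" for v
  proof -
    have fN: "finite (N v)" using sub(1)[OF v] fin(2) by (rule finite_subset)
    have "inj_on \<kappa> (N v)" using inj sub(1)[OF v] by (rule inj_on_subset)
    from telescope_ranked[OF fN this, of "ent F" "T v"]
    have "ent F (N v \<union> T v) - ent F (T v) = (\<Sum>u\<in>N v. ent F (insert u ({w\<in>N v. \<kappa> w < \<kappa> u} \<union> T v))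
        - ent F ({w\<in>N v. \<kappa> w < \<kappa> u} \<union> T v))" .
    also have "\<dots> \<ge> (\<Sum>u\<in>N v. \<delta> u)"
    proof (intro sum_mono)
      fix u assume "u \<in> N v"
      then have "{w\<in>N v. \<kappa> w < \<kappa> u} \<union> T v \<subseteq> {w\<in>Y. \<kappa> w < \<kappa> u}"
        using sub[OF v] below[OF v] by auto
      from ent_submodular[OF fin(1) this, of "{u}"]
      show "\<delta> u \<le> ent F (insert u ({w\<in>N v. \<kappa> w < \<kappa> u} \<union> T v))
        - ent F ({w\<in>N v. \<kappa> w < \<kappa> u} \<union> T v)" by (simp add: \<delta>_def)
    qed
    finally show ?thesis .
  qed
  have "ent F Y = (\<Sum>u\<in>Y. \<delta> u)"
    using telescope_ranked[OF fin(2) inj, of "ent F" "{}"] ent_empty[OF fin(1)] by (simp add: \<delta>_def)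
  then have "real r * ent F Y = (\<Sum>u\<in>Y. \<Sum>v | v \<in> I \<and> u \<in> N v. \<delta> u)"
    using cover by (simp add: sum_distrib_left)
  also have "\<dots> = (\<Sum>u\<in>Y. \<Sum>v\<in>I. if u \<in> N v then \<delta> u else 0)"
    using fin(3) by (intro sum.cong[OF refl] sum.mono_neutral_cong_left) auto
  also have "\<dots> = (\<Sum>v\<in>I. \<Sum>u\<in>Y. if u \<in> N v then \<delta> u else 0)"
    by (rule sum.swap)
  also have "\<dots> = (\<Sum>v\<in>I. \<Sum>u\<in>N v. \<delta> u)"
  proof (rule sum.cong[OF refl])
    fix v assume "v \<in> I"
    then have "Y \<inter> {u. u \<in> N v} = N v" using sub(1) by auto
    then show "(\<Sum>u\<in>Y. if u \<in> N v then \<delta> u else 0) = (\<Sum>u\<in>N v. \<delta> u)"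
      using fin(2) by (simp add: sum.If_cases)
  qed
  also have "\<dots> \<le> (\<Sum>v\<in>I. ent F (N v \<union> T v) - ent F (T v))"
    by (intro sum_mono ge)
  finally show ?thesis .
qed

section \<open>Colourings of layered regular bipartite graphs\<close>

text \<open>The value of \<open>eta\<close> for the complete graph (\<open>eta_complete\<close>):
  the largest product of two natural numbers with sum at most \<open>q\<close>.\<close>

definition balanced_product :: "nat \<Rightarrow> nat" where
  "balanced_product q = (q div 2) * (q - q div 2)"

lemma mult_diff_le_balanced_product:
  assumes "a \<le> q"
  shows "a * (q - a) \<le> balanced_product q"
proof -
  define h where "h = int (q div 2)"
  have "int q = 2 * h \<or> int q = 2 * h + 1" unfolding h_def by presburger
  \<comment> \<open>The first inequality is the claim for \<open>q = 2 h\<close>, the second the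
    claim for \<open>q = 2 h + 1\<close>; the second holds because no integer lies strictly between
    0 and 1.\<close>
  moreover have "0 \<le> (int a - h)\<^sup>2" "0 \<le> (int a - h) * (int a - h - 1)"
    by simp (cases "int a - h \<ge> 1"; simp add: mult_nonneg_nonneg mult_nonpos_nonpos)
  ultimately have "int a * (int q - int a) \<le> h * (int q - h)"
    by (elim disjE) (simp_all add: algebra_simps power2_eq_square)
  then have "int (a * (q - a)) \<le> int (balanced_product q)"
    using assms by (simp add: balanced_product_def h_def of_nat_diff)
  then show ?thesis by linarith
qed

lemma mult_le_balanced_product:
  assumes "a + b \<le> q"
  shows "a * b \<le> balanced_product q"
proof -
  have "a * b \<le> a * (q - a)" using assms by (intro mult_le_mono) auto
  then show ?thesis using mult_diff_le_balanced_product[of a q] assms by linarith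
qed

lemma balanced_product_pos: "2 \<le> q \<Longrightarrow> 0 < balanced_product q"
  by (auto simp: balanced_product_def)

text \<open>If a unit of the sum were left over, giving it to \<open>b\<close> would push the
  product above its maximum, as \<open>a > 0\<close>.\<close>

lemma mult_eq_balanced_product_imp:
  assumes "a + b \<le> q" "a * b = balanced_product q" "2 \<le> q"
  shows "a + b = q"
proof (rule ccontr)
  assume "a + b \<noteq> q"
  then have "a * Suc b \<le> balanced_product q"
    using assms(1) by (intro mult_le_balanced_product) auto
  moreover have "a > 0" using assms balanced_product_pos[of q] by (cases a) auto
  ultimately show False using assms(2) by simp
qed

lemma balanced_product_le_square: "balanced_product q \<le> q * q"
  unfolding balanced_product_def by (intro mult_le_mono) auto

text \<open>Quantifies a strict inequality between integers: \<open>n / e \<le> 1 - 1 / e\<close>,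
  so \<open>ln x \<le> x - 1\<close> yields a gap of \<open>1 / e\<close>, which
  \<open>ln 2 \<le> 1\<close> only widens.\<close>

lemma log2_gap:
  assumes "0 < n" "n < e"
  shows "log 2 (real n) + 1 / real e \<le> log 2 (real e)"
proof -
  have "1 / real e \<le> 1 - real n / real e"
    using assms by (simp add: field_simps)
  also have "\<dots> \<le> ln (real e / real n)"
    using ln_le_minus_one[of "real n / real e"] assms by (simp add: ln_div)
  also have "\<dots> \<le> ln (real e / real n) / ln 2"
  proof -
    have "0 \<le> ln (real e / real n)" using assms by simp
    moreover have "0 < ln (2::real)" "ln (2::real) \<le> 1" using ln_le_minus_one[of "2::real"] by auto
    ultimately show ?thesis by (simp add: pos_le_divide_eq mult_left_le)
  qed
  also have "\<dots> = log 2 (real e) - log 2 (real n)"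
    using assms by (simp add: log_def ln_div diff_divide_distrib)
  finally show ?thesis by simp
qed

text \<open>The constant is crude: one factor 2 comes from
  \<open>1 / (1 - x) - 1 \<le> 2 * x\<close> on this range, the other from
  \<open>ln 2 \<ge> 1/2\<close>.\<close>

lemma neg_log2_one_minus_le:
  fixes x :: real
  assumes "0 < x" "x \<le> 1/2"
  shows "- log 2 (1 - x) \<le> 4 * x"
proof -
  have l2: "(1/2::real) \<le> ln 2" using ln2_ge_two_thirds by simp
  have "- ln (1 - x) = ln (1 / (1 - x))" using assms by (simp add: ln_div)
  also have "\<dots> \<le> 1 / (1 - x) - 1" using assms by (intro ln_le_minus_one) auto
  also have "\<dots> \<le> 2 * x"
  proof -
    have "1 \<le> (1 + 2 * x) * (1 - x)" using assms by (simp add: algebra_simps)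
    then have "1 / (1 - x) \<le> 1 + 2 * x" using assms by (subst pos_divide_le_eq) auto
    then show ?thesis by simp
  qed
  also have "\<dots> \<le> 4 * x * ln 2" using l2 assms by simp
  finally have "- ln (1 - x) / ln 2 \<le> 4 * x" by (subst pos_divide_le_eq) auto
  then show ?thesis unfolding log_def by simp
qed

section \<open>Layered regular bipartite graphs\<close>

text \<open>What the entropy argument takes from the torus: an \<open>r\<close>-regular graph,
  bipartite by the parity of a level, whose edges join levels less than \<open>m\<close> apart. The
  distance allows for wraparound edges, which change the coordinate sum by
  \<open>m - 1\<close>.\<close>

locale layered_colouring =
  fixes V :: "'a set" and N :: "'a \<Rightarrow> 'a set" and lev :: "'a \<Rightarrow> nat" and r m q :: nat
  assumes finite_V: "finite V"
    and N_sub: "x \<in> V \<Longrightarrow> N x \<subseteq> V"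
    and N_sym: "x \<in> V \<Longrightarrow> y \<in> N x \<Longrightarrow> x \<in> N y"
    and card_N: "x \<in> V \<Longrightarrow> card (N x) = r"
    and r_pos: "0 < r"
    and lev_parity: "x \<in> V \<Longrightarrow> y \<in> N x \<Longrightarrow> even (lev y) \<noteq> even (lev x)"
    and lev_near: "x \<in> V \<Longrightarrow> y \<in> N x \<Longrightarrow> lev y < lev x + m"
    and q_ge_2: "2 \<le> q"
begin

definition Col :: "('a \<Rightarrow> nat) set" where
  "Col = {f \<in> V \<rightarrow>\<^sub>E {1..q}. \<forall>x\<in>V. \<forall>y\<in>N x. f x \<noteq> f y}"

definition side :: "bool \<Rightarrow> 'a set" where
  "side b = {x \<in> V. even (lev x) = b}"

definition low :: "'a \<Rightarrow> 'a set" where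
  "low x = {y \<in> N x. lev y < lev x}"

text \<open>By \<open>lev_parity\<close> no neighbour lies on the level of \<open>x\<close>, so
  these are the neighbours at larger levels.\<close>

definition upp :: "'a \<Rightarrow> 'a set" where
  "upp x = N x - low x"

text \<open>For colourings this says that the two images form a pair in \<open>max_pairs\<close> of
  the complete graph. Unlike \<open>ideal_edge\<close> it does not single out an even end.\<close>

definition ideal :: "('a \<Rightarrow> nat) \<Rightarrow> 'a \<Rightarrow> 'a \<Rightarrow> bool" where
  "ideal f x y \<longleftrightarrow> f ` N x \<inter> f ` N y = {} \<and> card (f ` N x) * card (f ` N y) = balanced_product q"

definition bad :: "('a \<Rightarrow> nat) \<Rightarrow> 'a \<Rightarrow> bool" where
  "bad f x \<longleftrightarrow> f ` low x \<noteq> f ` upp x \<or> card (f ` N x) * (q - card (f ` N x)) \<noteq> balanced_product q"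

lemma finite_N: "x \<in> V \<Longrightarrow> finite (N x)"
  using N_sub finite_V finite_subset by blast

lemma finite_Col: "finite Col"
  by (rule finite_subset[of _ "V \<rightarrow>\<^sub>E {1..q}"]) (auto simp: Col_def finite_V intro!: finite_PiE)

lemma Col_range: "f \<in> Col \<Longrightarrow> x \<in> V \<Longrightarrow> f x \<in> {1..q}"
  by (auto simp: Col_def)

lemma Col_image_sub: "f \<in> Col \<Longrightarrow> x \<in> V \<Longrightarrow> f ` N x \<subseteq> {1..q}"
  using Col_range N_sub by blast

lemma Col_notin_image: "f \<in> Col \<Longrightarrow> x \<in> V \<Longrightarrow> f x \<notin> f ` N x"
  by (force simp: Col_def)

lemma low_un_upp: "low x \<union> upp x = N x"
  by (auto simp: low_def upp_def)

lemma image_low_un_upp: "f ` N x = f ` low x \<union> f ` upp x"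
  by (metis image_Un low_un_upp)

lemma low_int_upp: "low x \<inter> upp x = {}"
  by (auto simp: upp_def)

lemma low_sub: "low x \<subseteq> N x" and upp_sub: "upp x \<subseteq> N x"
  by (auto simp: low_def upp_def)

lemma card_low_upp: "x \<in> V \<Longrightarrow> card (low x) + card (upp x) = r"
  using card_Un_disjoint[of "low x" "upp x"] low_un_upp[of x] low_int_upp[of x] card_N[of x]
    finite_subset[OF low_sub finite_N] finite_subset[OF upp_sub finite_N] by simp

lemma finite_side: "finite (side b)"
  using finite_V by (simp add: side_def)

lemma side_sub: "side b \<subseteq> V"
  by (auto simp: side_def)

lemma V_eq_sides: "V = side b \<union> side (\<not> b)" and sides_disjoint: "side b \<inter> side (\<not> b) = {}"
  by (auto simp: side_def)

lemma N_side: "x \<in> side b \<Longrightarrow> N x \<subseteq> side (\<not> b)"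
  using N_sub lev_parity by (auto simp: side_def)

lemma N_conv: "x \<in> V \<Longrightarrow> y \<in> V \<Longrightarrow> y \<in> N x \<longleftrightarrow> x \<in> N y"
  using N_sym by blast

lemma nbrs_in_side: "u \<in> side (\<not> b) \<Longrightarrow> {v \<in> side b. u \<in> N v} = N u"
  using N_side[of u "\<not> b"] N_conv side_sub by (auto, blast+)

lemma sum_edges_swap:
  fixes g :: "'a \<Rightarrow> 'a \<Rightarrow> real"
  shows "(\<Sum>u\<in>side b. \<Sum>v\<in>N u. g u v) = (\<Sum>v\<in>side (\<not> b). \<Sum>u\<in>N v. g u v)"
proof -
  have "(\<Sum>u\<in>side b. \<Sum>v\<in>N u. g u v) = (\<Sum>u\<in>side b. \<Sum>v\<in>side (\<not> b). if v \<in> N u then g u v else 0)"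
    using N_side by (intro sum.cong[OF refl] sum.mono_neutral_cong_left) (auto simp: finite_side)
  also have "\<dots> = (\<Sum>v\<in>side (\<not> b). \<Sum>u\<in>side b. if v \<in> N u then g u v else 0)"
    by (rule sum.swap)
  also have "\<dots> = (\<Sum>v\<in>side (\<not> b). \<Sum>u\<in>N v. g u v)"
    using nbrs_in_side[of _ b]
    by (intro sum.cong[OF refl] sum.mono_neutral_cong_right) (auto simp: finite_side)
  finally show ?thesis .
qed

lemma card_sides: "card (side b) = card (side (\<not> b))"
proof -
  have "real r * real (card (side b)) = (\<Sum>u\<in>side b. \<Sum>v\<in>N u. 1)"
    using card_N side_sub[of b] by (simp add: subset_iff)
  also have "\<dots> = real r * real (card (side (\<not> b)))"
    by (subst sum_edges_swap) (use card_N side_sub[of "\<not> b"] in \<open>simp add: subset_iff\<close>)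
  finally show ?thesis using r_pos by simp
qed

lemma card_V: "card V = 2 * card (side b)"
  using card_Un_disjoint[OF finite_side[of b] finite_side[of "\<not> b"] sides_disjoint] V_eq_sides[of b]
    card_sides[of b] by simp

text \<open>Using the first \<open>q div 2\<close> colours on one side and the remaining ones on the
  other always gives a proper colouring. Both entropy bounds are compared with this count.\<close>

lemma log_card_Col_ge:
  "Col \<noteq> {}" "real (card (side b)) * log 2 (real (balanced_product q)) \<le> log 2 (real (card Col))"
proof -
  define h where "h = q div 2"
  define F where "F x = (if x \<in> side True then {1..h} else {h + 1..q})" for x
  have h: "h \<le> q" by (simp add: h_def)
  have sub: "PiE V F \<subseteq> Col"
  proof
    fix f assume f: "f \<in> PiE V F"
    have "f x \<noteq> f y" if "x \<in> V" "y \<in> N x" for x y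
    proof -
      have y: "y \<in> V" using that N_sub by blast
      have "(x \<in> side True) \<noteq> (y \<in> side True)"
        using lev_parity[OF that] that(1) y by (auto simp: side_def)
      moreover have "f x \<in> F x" "f y \<in> F y" by (rule PiE_mem[OF f], fact)+
      ultimately show ?thesis by (auto simp: F_def split: if_splits)
    qed
    moreover have "f \<in> V \<rightarrow>\<^sub>E {1..q}"
    proof (rule PiE_I)
      fix x assume "x \<in> V"
      then have "f x \<in> F x" by (rule PiE_mem[OF f])
      then show "f x \<in> {1..q}" using h by (auto simp: F_def split: if_splits)
    next
      fix x assume "x \<notin> V"
      then show "f x = undefined" by (rule PiE_arb[OF f])
    qed
    ultimately show "f \<in> Col" by (simp add: Col_def)
  qed
  have "card (PiE V F) = (\<Prod>x\<in>V. card (F x))" by (rule card_PiE[OF finite_V])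
  also have "\<dots> = (\<Prod>x\<in>side True \<union> side False. card (F x))"
    using V_eq_sides[of True] by simp
  also have "\<dots> = (\<Prod>x\<in>side True. card (F x)) * (\<Prod>x\<in>side False. card (F x))"
    using sides_disjoint[of True] by (intro prod.union_disjoint finite_side) simp
  also have "(\<Prod>x\<in>side True. card (F x)) = h ^ card (side True)" by (simp add: F_def)
  also have "(\<Prod>x\<in>side False. card (F x)) = (\<Prod>x\<in>side False. q - h)"
    by (intro prod.cong) (auto simp: F_def side_def)
  also have "\<dots> = (q - h) ^ card (side False)" by simp
  also have "card (side False) = card (side True)" using card_sides[of True] by simp
  finally have c: "card (PiE V F) = balanced_product q ^ card (side True)"
    by (simp add: balanced_product_def power_mult_distrib h_def)
  have le: "balanced_product q ^ card (side True) \<le> card Col"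
    using card_mono[OF finite_Col sub] c by simp
  have pos: "0 < balanced_product q ^ card (side True)" using balanced_product_pos[OF q_ge_2] by simp
  then show "Col \<noteq> {}" using le by auto
  have "card (side b) = card (side True)" using card_sides[of True] by (cases b) auto
  then have "real (card (side b)) * log 2 (real (balanced_product q))
      = log 2 (real (balanced_product q ^ card (side True)))"
    using balanced_product_pos[OF q_ge_2] by (simp add: log_nat_power)
  also have "\<dots> \<le> log 2 (real (card Col))"
    using le pos by (intro log_mono) (auto simp del: of_nat_power)
  finally show "real (card (side b)) * log 2 (real (balanced_product q)) \<le> log 2 (real (card Col))" .
qed

lemma agree_Col_V: "f \<in> Col \<Longrightarrow> agree Col V f = {f}"
  by (auto simp: agree_def Col_def intro: PiE_ext)

lemma ent_V: "ent Col V = real (card Col) * log 2 (real (card Col))"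
  by (simp add: ent_def agree_Col_V)

lemma ent_side_given_other:
  "ent Col V - ent Col (side (\<not> b))
    \<le> (\<Sum>f\<in>Col. \<Sum>v\<in>side b. log 2 (real (q - card (f ` N v))))"
  unfolding ent_diff[OF finite_Col]
proof (rule sum_mono)
  fix f assume f: "f \<in> Col"
  let ?P = "\<lambda>v. {1..q} - f ` N v"
  have inj: "inj_on (\<lambda>g. restrict g (side b)) (agree Col (side (\<not> b)) f)"
  proof (rule inj_onI)
    fix g g' assume g: "g \<in> agree Col (side (\<not> b)) f" "g' \<in> agree Col (side (\<not> b)) f"
      and eq: "restrict g (side b) = restrict g' (side b)"
    have "g x = g' x" if "x \<in> V" for x
      using that g eq V_eq_sides[of b] unfolding restrict_eq_iff agree_def by auto
    then show "g = g'" using g by (auto simp: agree_def Col_def intro: PiE_ext)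
  qed
  have sub: "(\<lambda>g. restrict g (side b)) ` agree Col (side (\<not> b)) f \<subseteq> PiE (side b) ?P"
  proof (intro image_subsetI, rule PiE_I)
    fix g v assume g: "g \<in> agree Col (side (\<not> b)) f" and v: "v \<in> side b"
    have "g ` N v = f ` N v" using g N_side[OF v] by (intro image_cong) (auto simp: agree_def)
    moreover have "g v \<in> {1..q}" "g v \<notin> g ` N v"
      using g v side_sub Col_range Col_notin_image by (auto simp: agree_def subset_iff)
    ultimately show "restrict g (side b) v \<in> ?P v" using v by auto
  qed auto
  have "card (agree Col (side (\<not> b)) f) \<le> card (PiE (side b) ?P)"
    using card_inj_on_le[OF inj sub] finite_side by (simp add: finite_PiE)
  also have "\<dots> = (\<Prod>v\<in>side b. card (?P v))" by (rule card_PiE[OF finite_side])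
  also have "\<dots> = (\<Prod>v\<in>side b. q - card (f ` N v))"
  proof (intro prod.cong refl)
    fix v assume "v \<in> side b"
    then have "f ` N v \<subseteq> {1..q}" using Col_image_sub[OF f] side_sub by blast
    then show "card (?P v) = q - card (f ` N v)"
      by (subst card_Diff_subset) (auto intro: finite_subset)
  qed
  finally have le: "card (agree Col (side (\<not> b)) f) \<le> (\<Prod>v\<in>side b. q - card (f ` N v))" .
  have pos: "0 < card (agree Col (side (\<not> b)) f)" by (rule card_agree_pos[OF finite_Col f])
  \<comment> \<open>\<open>f\<close> itself is a completion, so no factor vanishes and the logarithm
    of the product splits.\<close>
  then have "(\<Prod>v\<in>side b. q - card (f ` N v)) \<noteq> 0" using le by linarith
  then have nz: "q - card (f ` N v) \<noteq> 0" if "v \<in> side b" for v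
    using that finite_side by (metis prod_zero_iff)
  have "log 2 (real (card (agree Col (side (\<not> b)) f))) \<le> log 2 (real (\<Prod>v\<in>side b. q - card (f ` N v)))"
    using le pos by (intro log_mono) (auto simp del: of_nat_prod)
  also have "\<dots> = (\<Sum>v\<in>side b. log 2 (real (q - card (f ` N v))))"
    unfolding of_nat_prod log_def using nz
    by (subst ln_prod) (auto simp: sum_divide_distrib finite_side)
  finally show "log 2 (real (card (agree Col (side (\<not> b)) f)) / real (card (agree Col V f)))
      \<le> (\<Sum>v\<in>side b. log 2 (real (q - card (f ` N v))))"
    by (simp add: agree_Col_V[OF f])
qed

lemma exists_rank:
  obtains \<kappa> :: "'a \<Rightarrow> nat" where "inj_on \<kappa> V"
    "\<And>x y. x \<in> V \<Longrightarrow> y \<in> V \<Longrightarrow> lev x < lev y \<Longrightarrow> \<kappa> x < \<kappa> y"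
proof -
  obtain e where e: "bij_betw e V {0..<card V}" using ex_bij_betw_finite_nat[OF finite_V] by blast
  \<comment> \<open>Lexicographic order: the level first, ties broken by an enumeration with values
    below \<open>card V\<close>.\<close>
  define \<kappa> where "\<kappa> x = lev x * card V + e x" for x
  have lt: "e x < card V" if "x \<in> V" for x using e that by (auto simp: bij_betw_def)
  have mono: "\<kappa> x < \<kappa> y" if "x \<in> V" "y \<in> V" "lev x < lev y" for x y
  proof -
    have "\<kappa> x < Suc (lev x) * card V" using lt[OF that(1)] by (simp add: \<kappa>_def)
    also have "\<dots> \<le> lev y * card V" using that(3) by (intro mult_le_mono1) simp
    finally show ?thesis by (simp add: \<kappa>_def)
  qed
  have "inj_on \<kappa> V"
  proof (rule inj_onI)
    fix x y assume xy: "x \<in> V" "y \<in> V" "\<kappa> x = \<kappa> y"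
    then have "lev x = lev y" using mono by (metis less_irrefl linorder_neqE_nat)
    then have "e x = e y" using xy(3) by (simp add: \<kappa>_def)
    then show "x = y" using e xy by (auto simp: bij_betw_def inj_on_def)
  qed
  then show ?thesis using that mono by blast
qed

section \<open>Entropy of one neighbourhood given a set of known colours\<close>

text \<open>A two-stage guess: the pair of images on the lower and upper neighbours is drawn with
  weights \<open>w f\<close>, which depend only on the colours on \<open>T\<close>; then each
  neighbour takes a uniform colour from its image. The first stage costs the \<open>- log 2\<close>
  term, the second the other two.\<close>

lemma ent_nbhd_le_kernel:
  fixes w :: "('a \<Rightarrow> nat) \<Rightarrow> nat set \<times> nat set \<Rightarrow> real"
  assumes v: "v \<in> V"
    and w_cong: "\<And>f g. f \<in> Col \<Longrightarrow> g \<in> agree Col T f \<Longrightarrow> w g = w f"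
    and w_nonneg: "\<And>f F. f \<in> Col \<Longrightarrow> 0 \<le> w f F"
    and w_sum: "\<And>f. f \<in> Col \<Longrightarrow> (\<Sum>F\<in>Pow {1..q} \<times> Pow {1..q}. w f F) \<le> 1"
    and w_pos: "\<And>f. f \<in> Col \<Longrightarrow> 0 < w f (f ` low v, f ` upp v)"
  shows "ent Col (N v \<union> T) - ent Col T \<le>
    (\<Sum>f\<in>Col. - log 2 (w f (f ` low v, f ` upp v)) +
       (real (card (low v)) * log 2 (real (card (f ` low v))) +
        real (card (upp v)) * log 2 (real (card (f ` upp v)))))"
proof -
  let ?I = "Pow {1..q} \<times> Pow {1..q}"
  \<comment> \<open>\<open>c F\<close> counts the maps on \<open>N v\<close> with lower values in
    \<open>fst F\<close> and upper values in \<open>snd F\<close>.\<close>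
  define c where "c F = real (card (fst F) ^ card (low v) * card (snd F) ^ card (upp v))"
    for F :: "nat set \<times> nat set"
  define i where "i f = (f ` low v, f ` upp v)" for f :: "'a \<Rightarrow> nat"
  have fin: "finite (low v)" "finite (upp v)"
    using finite_subset[OF low_sub finite_N[OF v]] finite_subset[OF upp_sub finite_N[OF v]] by auto
  have cpos: "card (f ` low v) ^ card (low v) > 0" "card (f ` upp v) ^ card (upp v) > 0" for f :: "'a \<Rightarrow> nat"
    using fin by (auto simp: card_gt_0_iff)
  have "ent Col (N v \<union> T) - ent Col T \<le> (\<Sum>f\<in>Col. - log 2 (w f (i f) / c (i f)))"
  proof (rule ent_diff_le_kernel[OF finite_Col])
    fix f assume f: "f \<in> Col"
    show "0 < w f (i f) / c (i f)"
      using w_pos[OF f] cpos[of f] by (simp add: c_def i_def del: of_nat_mult)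
    let ?\<phi> = "\<lambda>x. w f (i x) / c (i x)"
    have ir: "i (restrict g (N v)) = i g" for g
      using low_sub[of v] upp_sub[of v] by (auto simp: i_def restrict_def image_def subset_iff)
    have "(\<Sum>g\<in>agree Col T f. (w g (i g) / c (i g)) / real (card (agree Col (N v \<union> T) g)))
       = (\<Sum>g\<in>agree Col T f. ?\<phi> (restrict g (N v)) / real (card (agree Col (N v \<union> T) g)))"
      by (intro sum.cong refl) (simp only: ir w_cong[OF f])
    also have "\<dots> = (\<Sum>x\<in>(\<lambda>g. restrict g (N v)) ` agree Col T f. ?\<phi> x)"
      by (rule sum_agree_div_card[OF finite_Col])
    also have "\<dots> \<le> (\<Sum>x\<in>N v \<rightarrow>\<^sub>E {1..q}. ?\<phi> x)"
    proof (rule sum_mono2)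
      show "finite (N v \<rightarrow>\<^sub>E {1..q})" using finite_N[OF v] by (simp add: finite_PiE)
      show "(\<lambda>g. restrict g (N v)) ` agree Col T f \<subseteq> N v \<rightarrow>\<^sub>E {1..q}"
        using Col_range N_sub[OF v] by (fastforce simp: agree_def)
      show "0 \<le> ?\<phi> x" for x using w_nonneg[OF f] by (simp add: c_def)
    qed
    also have "\<dots> = (\<Sum>F\<in>?I. \<Sum>x | x \<in> N v \<rightarrow>\<^sub>E {1..q} \<and> i x = F. ?\<phi> x)"
    proof (rule sum.group[symmetric])
      show "finite (N v \<rightarrow>\<^sub>E {1..q})" using finite_N[OF v] by (simp add: finite_PiE)
      show "i ` (N v \<rightarrow>\<^sub>E {1..q}) \<subseteq> ?I"
        using low_sub[of v] upp_sub[of v] by (force simp: i_def PiE_def Pi_def)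
    qed auto
    also have "\<dots> \<le> (\<Sum>F\<in>?I. w f F)"
    proof (rule sum_mono)
      fix F assume F: "F \<in> ?I"
      let ?X = "{x \<in> N v \<rightarrow>\<^sub>E {1..q}. i x = F}"
      let ?G = "\<lambda>y. if y \<in> low v then fst F else snd F"
      have "finite (fst F)" "finite (snd F)" 
        using F finite_subset[of _ "{1..q}"] by auto
      then have fPi: "finite (PiE (N v) ?G)" using finite_N[OF v] by (intro finite_PiE) auto
      have "?X \<subseteq> PiE (N v) ?G"
        by (auto simp: i_def upp_def intro!: PiE_I)
      from card_mono[OF fPi this] have "card ?X \<le> (\<Prod>y\<in>N v. card (?G y))"
        using card_PiE[OF finite_N[OF v], of ?G] by simp
      also have "\<dots> = (\<Prod>y\<in>low v. card (?G y)) * (\<Prod>y\<in>upp v. card (?G y))"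
        using prod.union_disjoint[OF fin low_int_upp, of "\<lambda>y. card (?G y)"] by (simp only: low_un_upp)
      also have "(\<Prod>y\<in>upp v. card (?G y)) = (\<Prod>y\<in>upp v. card (snd F))"
        by (intro prod.cong) (auto simp: upp_def)
      finally have "real (card ?X) \<le> c F" by (simp add: c_def del: of_nat_mult)
      moreover have "0 \<le> c F" by (simp add: c_def)
      ultimately have "real (card ?X) / c F \<le> 1" by (auto simp: divide_le_eq_1 less_le)
      have "(\<Sum>x | x \<in> N v \<rightarrow>\<^sub>E {1..q} \<and> i x = F. ?\<phi> x) = w f F * (real (card ?X) / c F)"
        by simp
      also have "\<dots> \<le> w f F"
        using \<open>real (card ?X) / c F \<le> 1\<close> w_nonneg[OF f] by (rule mult_left_le)
      finally show "(\<Sum>x | x \<in> N v \<rightarrow>\<^sub>E {1..q} \<and> i x = F. ?\<phi> x) \<le> w f F" .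
    qed
    also have "\<dots> \<le> 1" by (rule w_sum[OF f])
    finally show "(\<Sum>g\<in>agree Col T f. (w g (i g) / c (i g)) / real (card (agree Col (N v \<union> T) g))) \<le> 1" .
  qed
  also have "\<dots> = (\<Sum>f\<in>Col. - log 2 (w f (f ` low v, f ` upp v)) +
       (real (card (low v)) * log 2 (real (card (f ` low v))) +
        real (card (upp v)) * log 2 (real (card (f ` upp v)))))"
  proof (rule sum.cong[OF refl])
    fix f assume f: "f \<in> Col"
    \<comment> \<open>The exponent 0 occurs when there are no lower or no upper neighbours; then
      \<open>n = 0\<close> as well and both sides are 0.\<close>
    have A: "log 2 (real n ^ k) = real k * log 2 (real n)" if "n ^ k > 0" for n k :: nat
      using that by (cases "k = 0") (auto simp: log_nat_power)
    have c: "c (i f) = real (card (f ` low v)) ^ card (low v) * real (card (f ` upp v)) ^ card (upp v)"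
      by (simp add: c_def i_def)
    have p: "0 < real (card (f ` low v)) ^ card (low v)" "0 < real (card (f ` upp v)) ^ card (upp v)"
      using cpos[of f] by (metis of_nat_0_less_iff of_nat_power)+
    show "- log 2 (w f (i f) / c (i f)) = - log 2 (w f (f ` low v, f ` upp v)) +
       (real (card (low v)) * log 2 (real (card (f ` low v))) +
        real (card (upp v)) * log 2 (real (card (f ` upp v))))"
      using w_pos[OF f] p A[OF cpos(1)[of f]] A[OF cpos(2)[of f]]
      by (simp add: c log_divide log_mult, simp add: i_def)
  qed
  finally show ?thesis .
qed

lemma card_image_N_bounds:
  assumes "f \<in> Col" "v \<in> V"
  shows "0 < card (f ` N v)" "card (f ` N v) < q"
proof -
  have "N v \<noteq> {}" using card_N[OF assms(2)] r_pos by auto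
  then show "0 < card (f ` N v)" using finite_N[OF assms(2)] by (simp add: card_gt_0_iff)
  have "f ` N v \<subseteq> {1..q} - {f v}"
    using Col_image_sub[OF assms] Col_notin_image[OF assms] by blast
  then have "card (f ` N v) \<le> card ({1..q} - {f v})" by (intro card_mono) auto
  also have "\<dots> < q" using Col_range[OF assms] q_ge_2 by (subst card_Diff_singleton) auto
  finally show "card (f ` N v) < q" .
qed

text \<open>Both partial images lie in \<open>f\<close> N
  v\<open>, so the left side is at most\<close>r\<open>times the logarithm of a product bounded by\<close>balanced_product
  q\<open>. A bad vertex loses at least\<close>s /
  q\<open>: a colour missing on one part costs\<close>1 / card (f \<open>N v)\<close> for each of at
  least \<open>s\<close> neighbours, and an unbalanced image costs
  \<open>r / balanced_product q\<close>, where \<open>s * q \<le> r\<close> and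
  \<open>balanced_product q \<le> q * q\<close>.\<close>

lemma part_log_le:
  assumes f: "f \<in> Col" and v: "v \<in> V"
    and s: "bad f v \<Longrightarrow> 0 < s \<Longrightarrow> s \<le> card (low v) \<and> s \<le> card (upp v)" and sq: "s * q \<le> r"
  shows "real (card (low v)) * log 2 (real (card (f ` low v)))
      + real (card (upp v)) * log 2 (real (card (f ` upp v)))
      + real r * log 2 (real (q - card (f ` N v)))
    \<le> real r * log 2 (real (balanced_product q)) - (if bad f v then real s / real q else 0)"
    (is "?L \<le> _")
proof -
  let ?C = "f ` N v" and ?a = "card (low v)" and ?b = "card (upp v)"
  have fin: "finite (low v)" "finite (upp v)"
    using finite_subset[OF low_sub finite_N[OF v]] finite_subset[OF upp_sub finite_N[OF v]] by auto
  note bnd = card_image_N_bounds[OF f v]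
  have r: "real r = real ?a + real ?b" using card_low_upp[OF v] by (metis of_nat_add)
  have finC: "finite ?C" using finite_N[OF v] by simp
  have sub: "f ` low v \<subseteq> ?C" "f ` upp v \<subseteq> ?C" using low_sub upp_sub by blast+
  have part: "real (card X) * log 2 (real (card (f ` X))) \<le> real (card X) * log 2 (real (card ?C))
      - (if card (f ` X) < card ?C \<and> s \<le> card X then real s / real q else 0)"
    if X: "X \<subseteq> N v" for X
  proof (cases "X = {}")
    case True
    then show ?thesis by auto
  next
    case False
    have fX: "finite X" using X finite_N[OF v] finite_subset by blast
    have pos: "0 < card (f ` X)" using False fX by (simp add: card_gt_0_iff)
    have le: "card (f ` X) \<le> card ?C" using X finC by (intro card_mono) auto
    show ?thesis
    proof (cases "card (f ` X) < card ?C \<and> s \<le> card X")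
      case True
      have "real s / real q \<le> real (card X) / real (card ?C)"
        using True bnd by (intro frac_le) auto
      moreover have "real (card X) * (log 2 (real (card (f ` X))) + 1 / real (card ?C))
          \<le> real (card X) * log 2 (real (card ?C))"
        using log2_gap[OF pos] True by (intro mult_left_mono) auto
      ultimately show ?thesis using True by (simp add: algebra_simps)
    next
      case False
      have "log 2 (real (card (f ` X))) \<le> log 2 (real (card ?C))"
        using pos le by (intro log_mono) auto
      then show ?thesis using False by (auto intro: mult_left_mono)
    qed
  qed
  let ?P = "card ?C * (q - card ?C)"
  have Ppos: "0 < ?P" using bnd by simp
  have Ple: "?P \<le> balanced_product q" using bnd by (intro mult_diff_le_balanced_product) simp
  have logP: "real r * log 2 (real (card ?C)) + real r * log 2 (real (q - card ?C)) = real r * log 2 (real ?P)"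
    using bnd by (simp add: log_mult distrib_left)
  have Plog: "real r * log 2 (real ?P) \<le> real r * log 2 (real (balanced_product q))"
    using Ppos Ple by (intro mult_left_mono log_mono) (auto simp del: of_nat_mult)
  define g where "g X = (if card (f ` X) < card ?C \<and> s \<le> card X then real s / real q else 0)" for X
  have g0: "0 \<le> g X" for X by (simp add: g_def)
  have L: "?L \<le> real r * log 2 (real ?P) - g (low v) - g (upp v)"
    using part[OF low_sub] part[OF upp_sub] logP
    unfolding r g_def by (simp add: algebra_simps)
  show ?thesis
  proof (cases "bad f v \<and> 0 < s")
    case False
    then have "(if bad f v then real s / real q else 0) = 0" by auto
    then show ?thesis using L Plog g0[of "low v"] g0[of "upp v"] by linarith
  next
    case True
    then have s': "s \<le> ?a" "s \<le> ?b" using s by auto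
    show ?thesis
    proof (cases "card (f ` low v) < card ?C \<or> card (f ` upp v) < card ?C")
      case c: True
      have "real s / real q \<le> g (low v) + g (upp v)"
        using c s' g0[of "low v"] g0[of "upp v"] by (auto simp: g_def)
      then show ?thesis using L Plog True by simp
    next
      case c: False
      then have "f ` low v = ?C" "f ` upp v = ?C"
        using card_seteq[OF finC sub(1)] card_seteq[OF finC sub(2)] by simp_all
      then have "?P \<noteq> balanced_product q" using True by (auto simp: bad_def)
      then have "?P < balanced_product q" using Ple by simp
      from log2_gap[OF Ppos this]
      have "real r * (log 2 (real ?P) + 1 / real (balanced_product q))
         \<le> real r * log 2 (real (balanced_product q))" by (rule mult_left_mono) simp
      moreover have "real s / real q \<le> real r / real (balanced_product q)"
      proof -
        have "real s / real q = real (s * q) / real (q * q)" using q_ge_2 by simp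
        also have "\<dots> \<le> real r / real (balanced_product q)"
          using sq balanced_product_le_square[of q] balanced_product_pos[OF q_ge_2]
          by (intro frac_le) (auto simp del: of_nat_mult)
        finally show ?thesis .
      qed
      ultimately show ?thesis using L g0[of "low v"] g0[of "upp v"] True
        by (simp add: algebra_simps)
    qed
  qed
qed

text \<open>All \<open>4 ^ q\<close> pairs of colour sets get equal weight, which costs
  \<open>2 q\<close> bits. This serves the exceptional vertices outside \<open>W\<close>.\<close>

lemma ent_nbhd_le_uniform:
  assumes v: "v \<in> V"
  shows "ent Col (N v \<union> T) - ent Col T +
      (\<Sum>f\<in>Col. real r * log 2 (real (q - card (f ` N v))))
    \<le> real (card Col) * (real r * log 2 (real (balanced_product q)) + 2 * real q)"
proof -
  let ?w = "\<lambda>f F. 1 / (4::real) ^ q"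
  have "card (Pow {1..q} \<times> Pow {1..q}) = 4 ^ q"
    by (simp add: card_cartesian_product card_Pow power_mult_distrib[symmetric])
  then have "ent Col (N v \<union> T) - ent Col T \<le>
    (\<Sum>f\<in>Col. - log 2 (1 / (4::real) ^ q) +
       (real (card (low v)) * log 2 (real (card (f ` low v))) +
        real (card (upp v)) * log 2 (real (card (f ` upp v)))))"
    by (intro ent_nbhd_le_kernel[OF v, of T ?w]) auto
  moreover have "log 2 (1 / (4::real) ^ q) = - 2 * real q"
  proof -
    have "log 2 (4::real) = 2" using log_pow_cancel[of "2::real" 2] by simp
    then show ?thesis by (simp add: log_divide log_nat_power)
  qed
  ultimately have "ent Col (N v \<union> T) - ent Col T + (\<Sum>f\<in>Col. real r * log 2 (real (q - card (f ` N v))))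
    \<le> (\<Sum>f\<in>Col. 2 * real q + (real (card (low v)) * log 2 (real (card (f ` low v))) +
        real (card (upp v)) * log 2 (real (card (f ` upp v))) + real r * log 2 (real (q - card (f ` N v)))))"
    by (simp add: sum.distrib)
  also have "\<dots> \<le> (\<Sum>f\<in>Col. 2 * real q + real r * log 2 (real (balanced_product q)))"
  proof (rule sum_mono)
    fix f assume "f \<in> Col"
    \<comment> \<open>With \<open>s = 0\<close> the condition on \<open>s\<close> is vacuous and the
      gain at bad vertices is 0.\<close>
    from part_log_le[OF this v, of 0]
    show "2 * real q + (real (card (low v)) * log 2 (real (card (f ` low v))) +
        real (card (upp v)) * log 2 (real (card (f ` upp v))) + real r * log 2 (real (q - card (f ` N v))))
        \<le> 2 * real q + real r * log 2 (real (balanced_product q))" by (simp split: if_splits)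
  qed
  finally show ?thesis by (simp add: algebra_simps)
qed

lemma ent_nbhd_le_predicted:
  fixes \<epsilon> :: real
  assumes v: "v \<in> V" and v': "v' \<in> V" "N v' \<subseteq> T"
    and s: "0 < s" "s \<le> card (low v)" "s \<le> card (upp v)" "s * q \<le> r"
    and \<epsilon>: "0 < \<epsilon>" "\<epsilon> \<le> 1/2"
  shows "ent Col (N v \<union> T) - ent Col T +
      (\<Sum>f\<in>Col. real r * log 2 (real (q - card (f ` N v))))
    \<le> real (card Col) * (real r * log 2 (real (balanced_product q)) + 4 * \<epsilon>)
      + (log 2 (1 / \<epsilon>) + 2 * real q) *
          (real (card {f \<in> Col. f ` N v \<noteq> f ` N v'}) + real (card {f \<in> Col. bad f v}))
      - real s / real q * real (card {f \<in> Col. bad f v})"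
proof -
  define \<Lambda> where "\<Lambda> = log 2 (1 / \<epsilon>) + 2 * real q"
  \<comment> \<open>Mass \<open>1 - \<epsilon>\<close> on the prediction, and
    \<open>\<epsilon>\<close> spread evenly over all \<open>4 ^ q\<close> pairs so that every pair
    has positive weight.\<close>
  define w where "w f F = (if F = (f ` N v', f ` N v') then 1 - \<epsilon> else 0) + \<epsilon> / 4 ^ q"
    for f :: "'a \<Rightarrow> nat" and F :: "nat set \<times> nat set"
  have \<Lambda>0: "0 \<le> \<Lambda>" using \<epsilon> by (simp add: \<Lambda>_def)
  have cI: "card (Pow {1..q} \<times> Pow {1..q}) = 4 ^ q"
    by (simp add: card_cartesian_product card_Pow power_mult_distrib[symmetric])
  have w_lower: "\<epsilon> / 4 ^ q \<le> w f F" for f F using \<epsilon> by (simp add: w_def)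
  have w_pos: "0 < w f F" for f F
    using w_lower[of f F] \<epsilon> by (smt (verit) divide_pos_pos zero_less_power)
  have "ent Col (N v \<union> T) - ent Col T \<le>
    (\<Sum>f\<in>Col. - log 2 (w f (f ` low v, f ` upp v)) +
       (real (card (low v)) * log 2 (real (card (f ` low v))) +
        real (card (upp v)) * log 2 (real (card (f ` upp v)))))"
  proof (rule ent_nbhd_le_kernel[OF v])
    fix f g assume "f \<in> Col" "g \<in> agree Col T f"
    then have "g ` N v' = f ` N v'" using v' by (intro image_cong) (auto simp: agree_def)
    then show "w g = w f" by (simp add: w_def fun_eq_iff)
  next
    fix f assume f: "f \<in> Col"
    have "(\<Sum>F\<in>Pow {1..q} \<times> Pow {1..q}. w f F)
        = (\<Sum>F\<in>Pow {1..q} \<times> Pow {1..q}. if F = (f ` N v', f ` N v') then 1 - \<epsilon> else 0) + \<epsilon>"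
      using cI by (simp add: w_def sum.distrib)
    also have "\<dots> \<le> 1" using \<epsilon> by (simp add: sum.delta)
    finally show "(\<Sum>F\<in>Pow {1..q} \<times> Pow {1..q}. w f F) \<le> 1" .
  qed (use w_pos in \<open>auto intro: less_imp_le\<close>)
  then have "ent Col (N v \<union> T) - ent Col T + (\<Sum>f\<in>Col. real r * log 2 (real (q - card (f ` N v))))
    \<le> (\<Sum>f\<in>Col. - log 2 (w f (f ` low v, f ` upp v)) +
       (real (card (low v)) * log 2 (real (card (f ` low v))) +
        real (card (upp v)) * log 2 (real (card (f ` upp v))) + real r * log 2 (real (q - card (f ` N v)))))"
    unfolding sum.distrib by linarith
  also have "\<dots> \<le> (\<Sum>f\<in>Col. (real r * log 2 (real (balanced_product q)) + 4 * \<epsilon>)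
      + \<Lambda> * ((if f ` N v \<noteq> f ` N v' then 1 else 0) + (if bad f v then 1 else 0))
      - real s / real q * (if bad f v then 1 else 0))"
  proof (rule sum_mono)
    fix f assume f: "f \<in> Col"
    have "- log 2 (w f (f ` low v, f ` upp v)) \<le> 4 * \<epsilon> +
        \<Lambda> * ((if f ` N v \<noteq> f ` N v' then 1 else 0) + (if bad f v then 1 else 0))"
    proof (cases "bad f v \<or> f ` N v \<noteq> f ` N v'")
      case True
      have "- log 2 (w f (f ` low v, f ` upp v)) \<le> - log 2 (\<epsilon> / 4 ^ q)"
        using w_lower \<epsilon> by (intro le_imp_neg_le log_mono) auto
      also have "\<dots> = \<Lambda>"
      proof -
        have "log 2 (4::real) = 2" using log_pow_cancel[of "2::real" 2] by simp
        then show ?thesis using \<epsilon> by (simp add: \<Lambda>_def log_divide log_nat_power)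
      qed
      also have "\<dots> \<le> 4 * \<epsilon> + \<Lambda> * ((if f ` N v \<noteq> f ` N v' then 1 else 0) + (if bad f v then 1 else 0))"
        using True \<epsilon> \<Lambda>0 by auto
      finally show ?thesis .
    next
      case False
      then have "f ` low v = f ` N v'" "f ` upp v = f ` N v'"
        using image_low_un_upp[of f v] by (auto simp: bad_def)
      then have "w f (f ` low v, f ` upp v) \<ge> 1 - \<epsilon>" using \<epsilon> by (simp add: w_def)
      then have "- log 2 (w f (f ` low v, f ` upp v)) \<le> - log 2 (1 - \<epsilon>)" using \<epsilon> by simp
      also have "\<dots> \<le> 4 * \<epsilon>" by (rule neg_log2_one_minus_le[OF \<epsilon>])
      finally show ?thesis using False by simp
    qed
    moreover have "real (card (low v)) * log 2 (real (card (f ` low v)))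
      + real (card (upp v)) * log 2 (real (card (f ` upp v)))
      + real r * log 2 (real (q - card (f ` N v)))
    \<le> real r * log 2 (real (balanced_product q)) - (if bad f v then real s / real q else 0)"
      using s by (intro part_log_le[OF f v]) auto
    ultimately show "- log 2 (w f (f ` low v, f ` upp v)) +
       (real (card (low v)) * log 2 (real (card (f ` low v))) +
        real (card (upp v)) * log 2 (real (card (f ` upp v))) + real r * log 2 (real (q - card (f ` N v))))
      \<le> (real r * log 2 (real (balanced_product q)) + 4 * \<epsilon>)
      + \<Lambda> * ((if f ` N v \<noteq> f ` N v' then 1 else 0) + (if bad f v then 1 else 0))
      - real s / real q * (if bad f v then 1 else 0)"
      by (auto split: if_splits)
  qed
  also have "\<dots> = real (card Col) * (real r * log 2 (real (balanced_product q)) + 4 * \<epsilon>)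
      + \<Lambda> * (real (card {f \<in> Col. f ` N v \<noteq> f ` N v'}) + real (card {f \<in> Col. bad f v}))
      - real s / real q * real (card {f \<in> Col. bad f v})"
  proof -
    have ind: "(\<Sum>f\<in>Col. if P f then 1 else 0) = real (card {f \<in> Col. P f})" for P
      using finite_Col by (simp add: sum.If_cases Int_def)
    show ?thesis
      unfolding sum_subtractf sum.distrib sum_distrib_left[symmetric] ind by (simp add: algebra_simps)
  qed
  finally show ?thesis by (simp add: \<Lambda>_def)
qed

section \<open>The Shearer bound for the number of bad vertices\<close>

text \<open>Shearer's inequality for one side and the count of completions for the other bound the
  entropy of the whole colouring by a sum over \<open>side b\<close>. The main terms cancel against
  \<open>log_card_Col_ge\<close>, so what bad vertices save is at most what the predictions and the
  exceptional vertices cost.\<close>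

lemma sum_bad_side_le:
  fixes \<epsilon> K :: real
  assumes W: "W \<subseteq> V"
    and s: "0 < s" "\<And>v. v \<in> W \<Longrightarrow> s \<le> card (low v)" "\<And>v. v \<in> W \<Longrightarrow> s \<le> card (upp v)" "s * q \<le> r"
    and \<epsilon>: "0 < \<epsilon>" "\<epsilon> \<le> 1/2"
    and anc: "\<And>v. v \<in> W \<Longrightarrow> \<exists>v'\<in>V. lev v' + 2 * m \<le> lev v \<and> (even (lev v') \<longleftrightarrow> even (lev v)) \<and>
       real (card {f \<in> Col. f ` N v \<noteq> f ` N v'}) \<le> K"
  shows "real s / real q * (\<Sum>v\<in>side b \<inter> W. real (card {f \<in> Col. bad f v}))
    \<le> real (card (side b \<inter> W)) * (4 * \<epsilon> * real (card Col))
      + (log 2 (1 / \<epsilon>) + 2 * real q) *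
          (K * real (card (side b \<inter> W)) + (\<Sum>v\<in>side b \<inter> W. real (card {f \<in> Col. bad f v})))
      + 2 * real q * real (card (side b - W)) * real (card Col)"
proof -
  define \<Lambda> where "\<Lambda> = log 2 (1 / \<epsilon>) + 2 * real q"
  define n where "n = real (card Col)"
  define \<eta> where "\<eta> = log 2 (real (balanced_product q))"
  define bc where "bc v = real (card {f \<in> Col. bad f v})" for v
  have \<Lambda>0: "0 \<le> \<Lambda>" using \<epsilon> by (simp add: \<Lambda>_def)
  \<comment> \<open>A margin of \<open>m\<close> levels puts \<open>T v\<close> below every
    neighbour of \<open>v\<close>, as Shearer's inequality requires. An ancestor
    \<open>2 * m\<close> levels down has its neighbours at least \<open>m\<close> levels below
    \<open>v\<close>, hence inside \<open>T v\<close>.\<close>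
  define T where "T v = {u \<in> side (\<not> b). lev u + m \<le> lev v}" for v
  define t where "t v = ent Col (N v \<union> T v) - ent Col (T v) +
      (\<Sum>f\<in>Col. real r * log 2 (real (q - card (f ` N v))))" for v
  obtain \<kappa> :: "'a \<Rightarrow> nat" where \<kappa>: "inj_on \<kappa> V"
    "\<And>x y. x \<in> V \<Longrightarrow> y \<in> V \<Longrightarrow> lev x < lev y \<Longrightarrow> \<kappa> x < \<kappa> y" by (rule exists_rank) blast
  have "real r * ent Col (side (\<not> b)) \<le> (\<Sum>v\<in>side b. ent Col (N v \<union> T v) - ent Col (T v))"
  proof (rule shearer_ranked[where \<kappa> = \<kappa>])
    show "inj_on \<kappa> (side (\<not> b))" using \<kappa>(1) side_sub by (rule inj_on_subset)
    show "N v \<subseteq> side (\<not> b)" if "v \<in> side b" for v by (rule N_side[OF that])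
    show "T v \<subseteq> side (\<not> b)" for v by (auto simp: T_def)
    show "card {v \<in> side b. u \<in> N v} = r" if "u \<in> side (\<not> b)" for u
      using nbrs_in_side[OF that] card_N that side_sub by (auto simp: subset_iff)
    fix v w u assume v: "v \<in> side b" and w: "w \<in> T v" and u: "u \<in> N v"
    have V: "v \<in> V" "u \<in> V" "w \<in> V" using v w u side_sub N_sub by (auto simp: T_def side_def)
    have "lev v < lev u + m" using lev_near[OF V(2) N_sym[OF V(1) u]] .
    then have "lev w < lev u" using w by (auto simp: T_def)
    then show "\<kappa> w < \<kappa> u" using \<kappa>(2) V by blast
  qed (auto simp: finite_Col finite_side)
  moreover have "real r * (ent Col V - ent Col (side (\<not> b)))
      \<le> real r * (\<Sum>f\<in>Col. \<Sum>v\<in>side b. log 2 (real (q - card (f ` N v))))"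
    by (intro mult_left_mono ent_side_given_other) simp
  moreover have "real r * (\<Sum>f\<in>Col. \<Sum>v\<in>side b. log 2 (real (q - card (f ` N v))))
      = (\<Sum>v\<in>side b. \<Sum>f\<in>Col. real r * log 2 (real (q - card (f ` N v))))"
    by (subst sum.swap) (simp add: sum_distrib_left)
  ultimately have "real r * ent Col V \<le> (\<Sum>v\<in>side b. t v)"
    unfolding t_def sum.distrib by (simp add: algebra_simps)
  also have "\<dots> = (\<Sum>v\<in>side b \<inter> W. t v) + (\<Sum>v\<in>side b - W. t v)"
    by (rule sum.Int_Diff[OF finite_side])
  also have "\<dots> \<le> (\<Sum>v\<in>side b \<inter> W. n * (real r * \<eta> + 4 * \<epsilon>) + \<Lambda> * (K + bc v) - real s / real q * bc v)
      + (\<Sum>v\<in>side b - W. n * (real r * \<eta> + 2 * real q))"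
  proof (intro add_mono sum_mono)
    fix v assume v: "v \<in> side b \<inter> W"
    then obtain v' where v': "v' \<in> V" "lev v' + 2 * m \<le> lev v" "even (lev v') \<longleftrightarrow> even (lev v)"
       "real (card {f \<in> Col. f ` N v \<noteq> f ` N v'}) \<le> K" using anc by blast
    have "N v' \<subseteq> side (\<not> b)" using v v' by (intro N_side) (auto simp: side_def)
    then have sub: "N v' \<subseteq> T v" using v'(2) lev_near[OF v'(1)] by (fastforce simp: T_def)
    have "v \<in> V" using v W by blast
    from ent_nbhd_le_predicted[OF this v'(1) sub s(1) s(2) s(3) s(4) \<epsilon>] v
    have "t v \<le> n * (real r * \<eta> + 4 * \<epsilon>)
      + \<Lambda> * (real (card {f \<in> Col. f ` N v \<noteq> f ` N v'}) + bc v) - real s / real q * bc v"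
      unfolding t_def n_def \<eta>_def \<Lambda>_def bc_def by blast
    also have "\<dots> \<le> n * (real r * \<eta> + 4 * \<epsilon>) + \<Lambda> * (K + bc v) - real s / real q * bc v"
      using v'(4) \<Lambda>0 by (simp add: mult_left_mono)
    finally show "t v \<le> n * (real r * \<eta> + 4 * \<epsilon>) + \<Lambda> * (K + bc v) - real s / real q * bc v" .
  next
    fix v assume "v \<in> side b - W"
    then have "v \<in> V" using side_sub by blast
    from ent_nbhd_le_uniform[OF this]
    show "t v \<le> n * (real r * \<eta> + 2 * real q)" unfolding t_def n_def \<eta>_def .
  qed
  also have "\<dots> = (real (card (side b \<inter> W)) + real (card (side b - W))) * (n * real r * \<eta>)
      + real (card (side b \<inter> W)) * (4 * \<epsilon> * n)
      + \<Lambda> * (K * real (card (side b \<inter> W)) + (\<Sum>v\<in>side b \<inter> W. bc v))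
      - real s / real q * (\<Sum>v\<in>side b \<inter> W. bc v)
      + 2 * real q * real (card (side b - W)) * n"
    unfolding sum_subtractf sum.distrib sum_distrib_left[symmetric] by (simp add: algebra_simps)
  also have "real (card (side b \<inter> W)) + real (card (side b - W)) = real (card (side b))"
    using card_Int_Diff[OF finite_side[of b], of W] by (simp flip: of_nat_add)
  finally have "real r * ent Col V \<le> real (card (side b)) * (n * real r * \<eta>)
      + real (card (side b \<inter> W)) * (4 * \<epsilon> * n)
      + \<Lambda> * (K * real (card (side b \<inter> W)) + (\<Sum>v\<in>side b \<inter> W. bc v))
      - real s / real q * (\<Sum>v\<in>side b \<inter> W. bc v)
      + 2 * real q * real (card (side b - W)) * n" .
  moreover have "real (card (side b)) * (n * real r * \<eta>) \<le> real r * ent Col V"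
  proof -
    have "real r * n * (real (card (side b)) * \<eta>) \<le> real r * n * log 2 n"
      unfolding n_def \<eta>_def by (intro mult_left_mono log_card_Col_ge) auto
    then show ?thesis by (simp add: ent_V n_def algebra_simps)
  qed
  ultimately show ?thesis
    unfolding \<Lambda>_def[symmetric] n_def[symmetric] bc_def[symmetric] by linarith
qed

section \<open>The chain rule along the levels\<close>

text \<open>The colour of \<open>x\<close> avoids those of its lower neighbours; the guess is
  uniform on the others.\<close>

lemma ent_vertex_given_low:
  assumes x: "x \<in> V"
  shows "ent Col ({x} \<union> low x) - ent Col (low x) \<le> (\<Sum>f\<in>Col. log 2 (real (q - card (f ` low x))))"
proof -
  let ?K = "\<lambda>f. 1 / real (q - card (f ` low x))"
  have lt: "card (f ` low x) < q" if "f \<in> Col" for f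
    using card_image_N_bounds(2)[OF that x] card_mono[of "f ` N x" "f ` low x"] finite_N[OF x] low_sub[of x]
    by (meson finite_imageI image_mono le_less_trans)
  have "ent Col ({x} \<union> low x) - ent Col (low x) \<le> (\<Sum>f\<in>Col. - log 2 (?K f))"
  proof (rule ent_diff_le_kernel[OF finite_Col])
    fix f assume f: "f \<in> Col"
    show "0 < ?K f" using lt[OF f] by simp
    have im: "g ` low x = f ` low x" if "g \<in> agree Col (low x) f" for g
      using that by (intro image_cong) (auto simp: agree_def)
    let ?R = "(\<lambda>g. restrict g {x}) ` agree Col (low x) f"
    have "card ?R \<le> card ({1..q} - f ` low x)"
    proof (rule card_inj_on_le[where f = "\<lambda>h. h x"])
      show "inj_on (\<lambda>h. h x) ?R" by (auto simp: inj_on_def restrict_eq_iff)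
      have "g x \<in> {1..q} - f ` low x" if g: "g \<in> agree Col (low x) f" for g
      proof -
        have "g \<in> Col" using g by (simp add: agree_def)
        moreover have "g x \<notin> g ` low x" using Col_notin_image[OF \<open>g \<in> Col\<close> x] low_sub by blast
        ultimately show ?thesis using Col_range[OF _ x] im[OF g] by auto
      qed
      then show "(\<lambda>h. h x) ` ?R \<subseteq> {1..q} - f ` low x"
        unfolding image_image by (intro image_subsetI) simp
    qed auto
    also have "card ({1..q} - f ` low x) = q - card (f ` low x)"
    proof -
      have "f ` low x \<subseteq> {1..q}" using Col_image_sub[OF f x] low_sub by blast
      then show ?thesis by (subst card_Diff_subset) (auto intro: finite_subset)
    qed
    finally have cR: "card ?R \<le> q - card (f ` low x)" .
    have "(\<Sum>g\<in>agree Col (low x) f. ?K g / real (card (agree Col ({x} \<union> low x) g)))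
      = (\<Sum>g\<in>agree Col (low x) f. ?K f / real (card (agree Col ({x} \<union> low x) g)))"
      by (intro sum.cong refl) (simp only: im)
    also have "\<dots> = (\<Sum>y\<in>?R. ?K f)"
      using sum_agree_div_card[OF finite_Col, of "\<lambda>_. ?K f" "{x}" "low x" f] by simp
    also have "\<dots> = real (card ?R) * ?K f" by simp
    also have "\<dots> \<le> 1" using cR lt[OF f] by simp
    finally show "(\<Sum>g\<in>agree Col (low x) f. ?K g / real (card (agree Col ({x} \<union> low x) g))) \<le> 1" .
  qed
  also have "\<dots> = (\<Sum>f\<in>Col. log 2 (real (q - card (f ` low x))))"
  proof (intro sum.cong refl)
    fix f assume "f \<in> Col"
    then have "0 < real (q - card (f ` low x))" using lt by simp
    then show "- log 2 (?K f) = log 2 (real (q - card (f ` low x)))" by (subst log_divide) auto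
  qed
  finally show ?thesis .
qed

text \<open>In an order that respects levels the lower neighbours of \<open>x\<close> precede it;
  the rest of the past is dropped by submodularity.\<close>

lemma ent_V_le_low:
  "ent Col V \<le> (\<Sum>x\<in>V. \<Sum>f\<in>Col. log 2 (real (q - card (f ` low x))))"
proof -
  obtain \<kappa> :: "'a \<Rightarrow> nat" where \<kappa>: "inj_on \<kappa> V"
    "\<And>x y. x \<in> V \<Longrightarrow> y \<in> V \<Longrightarrow> lev x < lev y \<Longrightarrow> \<kappa> x < \<kappa> y" by (rule exists_rank) blast
  have "ent Col V = (\<Sum>x\<in>V. ent Col (insert x {w\<in>V. \<kappa> w < \<kappa> x}) - ent Col {w\<in>V. \<kappa> w < \<kappa> x})"
    using telescope_ranked[OF finite_V \<kappa>(1), of "ent Col" "{}"] ent_empty[OF finite_Col] by simp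
  also have "\<dots> \<le> (\<Sum>x\<in>V. \<Sum>f\<in>Col. log 2 (real (q - card (f ` low x))))"
  proof (rule sum_mono)
    fix x assume x: "x \<in> V"
    have "low x \<subseteq> {w\<in>V. \<kappa> w < \<kappa> x}" using \<kappa>(2) x N_sub[OF x] by (auto simp: low_def)
    from ent_submodular[OF finite_Col this, of "{x}"] ent_vertex_given_low[OF x]
    show "ent Col (insert x {w\<in>V. \<kappa> w < \<kappa> x}) - ent Col {w\<in>V. \<kappa> w < \<kappa> x}
      \<le> (\<Sum>f\<in>Col. log 2 (real (q - card (f ` low x))))" by simp
  qed
  finally show ?thesis .
qed

text \<open>Recolouring \<open>y\<close> with a colour missing from both neighbourhoods makes that colour occur exactly
  once around \<open>x\<close>.\<close>

lemma card_uncovered_le: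
  assumes x: "x \<in> V" and y: "y \<in> N x"
  shows "card {f \<in> Col. f ` N x \<union> f ` N y \<noteq> {1..q}} \<le> q * card {f \<in> Col. bad f x}"
proof -
  let ?A = "{f \<in> Col. f ` N x \<union> f ` N y \<noteq> {1..q}}"
  define k where "k f = (SOME c. c \<in> {1..q} \<and> c \<notin> f ` N x \<union> f ` N y)" for f
  have yV: "y \<in> V" using x y N_sub by blast
  have k: "k f \<in> {1..q}" "k f \<notin> f ` N x" "k f \<notin> f ` N y" if "f \<in> ?A" for f
  proof -
    have "\<exists>c. c \<in> {1..q} \<and> c \<notin> f ` N x \<union> f ` N y"
      using that Col_image_sub[of f x] Col_image_sub[of f y] x yV by blast
    from someI_ex[OF this] show "k f \<in> {1..q}" "k f \<notin> f ` N x" "k f \<notin> f ` N y"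
      by (simp_all add: k_def)
  qed
  \<comment> \<open>Keeping the old colour of \<open>y\<close> makes the map injective and accounts
    for the factor \<open>q\<close>.\<close>
  let ?\<Phi> = "\<lambda>f. (f y, f(y := k f))"
  have "inj_on ?\<Phi> ?A"
  proof (rule inj_onI)
    fix f g assume "?\<Phi> f = ?\<Phi> g"
    then have "f y = g y" "(f(y := k f))(y := f y) = (g(y := k g))(y := g y)" by simp_all
    then show "f = g" by (metis fun_upd_triv fun_upd_upd)
  qed
  moreover have "?\<Phi> ` ?A \<subseteq> {1..q} \<times> {f \<in> Col. bad f x}"
  proof (rule image_subsetI)
    fix f assume f: "f \<in> ?A"
    then have fC: "f \<in> Col" by simp
    let ?g = "f(y := k f)"
    have yN: "y \<notin> N y" using lev_parity[OF yV, of y] by auto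
    have "?g u \<noteq> ?g v" if u: "u \<in> V" and v: "v \<in> N u" for u v
    proof -
      have "f u \<noteq> f v" using fC u v by (auto simp: Col_def)
      moreover have "v \<in> N y \<Longrightarrow> k f \<noteq> f v" using k(3)[OF f] by blast
      moreover have "u = y \<Longrightarrow> v \<noteq> y" using yN v by blast
      moreover have "v = y \<Longrightarrow> k f \<noteq> f u" using k(3)[OF f] N_sym[OF u v] by blast
      ultimately show ?thesis using v by (auto simp: fun_upd_def)
    qed
    moreover have "?g \<in> V \<rightarrow>\<^sub>E {1..q}"
      using fC k(1)[OF f] yV by (auto simp: Col_def PiE_def Pi_def extensional_def)
    ultimately have gC: "?g \<in> Col" by (simp add: Col_def)
    \<comment> \<open>Around \<open>x\<close> the new colour occurs only at \<open>y\<close>, hence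
      in exactly one of the images of \<open>low x\<close> and \<open>upp x\<close>.\<close>
    have "k f \<in> ?g ` low x \<longleftrightarrow> y \<in> low x" "k f \<in> ?g ` upp x \<longleftrightarrow> y \<in> upp x"
      using k(2)[OF f] low_sub[of x] upp_sub[of x] by (force simp: image_iff)+
    moreover have "y \<in> low x \<longleftrightarrow> y \<notin> upp x" using y by (auto simp: upp_def)
    ultimately have "bad ?g x" by (auto simp: bad_def)
    then show "?\<Phi> f \<in> {1..q} \<times> {f \<in> Col. bad f x}"
      using gC Col_range[OF fC yV] by simp
  qed
  ultimately have "card ?A \<le> card ({1..q} \<times> {f \<in> Col. bad f x})"
    using finite_Col by (intro card_inj_on_le) auto
  then show ?thesis by (simp add: card_cartesian_product)
qed

text \<open>If no indicator in the last term is active, the images on the lower neighbours are the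
  full ones, and only ideal edges attain the maximal product; any other loses
  \<open>1 / balanced_product q\<close>. Otherwise \<open>3 * q\<close> pays for everything:
  \<open>q\<close> for each logarithm and \<open>q\<close> for the subtracted term.\<close>

lemma edge_log_le:
  assumes f: "f \<in> Col" and x: "x \<in> V" and y: "y \<in> N x"
  shows "log 2 (real (q - card (f ` low x))) + log 2 (real (q - card (f ` low y)))
    \<le> log 2 (real (balanced_product q)) - 1 / (real q)\<^sup>2 * of_bool (\<not> ideal f x y)
      + 3 * real q * (of_bool (bad f x) + of_bool (bad f y) + of_bool (f ` N x \<union> f ` N y \<noteq> {1..q}))"
proof -
  have yV: "y \<in> V" using x y N_sub by blast
  have \<eta>: "0 \<le> log 2 (real (balanced_product q))" using balanced_product_pos[OF q_ge_2] by simp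
  have q1: "1 / (real q)\<^sup>2 \<le> 1" using q_ge_2 by (simp add: divide_le_eq_1)
  show ?thesis
  proof (cases "bad f x \<or> bad f y \<or> f ` N x \<union> f ` N y \<noteq> {1..q}")
    case True
    \<comment> \<open>The case \<open>q - c = 0\<close> relies on the convention that
      \<open>log 2 0\<close> is 0.\<close>
    have lq: "log 2 (real (q - c)) \<le> real q" for c
    proof (cases "q - c = 0")
      case False
      have "real (q - c) \<le> 2 powr real q"
      proof -
        have "q - c \<le> 2 ^ q" using less_exp[of q] by linarith
        then show ?thesis by (simp add: powr_realpow)
      qed
      then show ?thesis using False by (subst log_le_iff) auto
    qed (simp add: log_def)
    have "1 \<le> of_bool (bad f x) + of_bool (bad f y) + (of_bool (f ` N x \<union> f ` N y \<noteq> {1..q}) :: real)"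
      using True by auto
    then have "3 * real q * 1 \<le> 3 * real q * (of_bool (bad f x) + of_bool (bad f y) + of_bool (f ` N x \<union> f ` N y \<noteq> {1..q}))"
      by (intro mult_left_mono) auto
    moreover have "1 / (real q)\<^sup>2 * of_bool (\<not> ideal f x y) \<le> real q"
      using order_trans[OF q1, of "real q"] q_ge_2 by (cases "ideal f x y") auto
    ultimately show ?thesis
      using lq[of "card (f ` low x)"] lq[of "card (f ` low y)"] \<eta> by linarith
  next
    case False
    then have eq: "f ` low x = f ` N x" "f ` low y = f ` N y" and un: "f ` N x \<union> f ` N y = {1..q}"
      using image_low_un_upp[of f x] image_low_un_upp[of f y] by (auto simp: bad_def)
    let ?a = "card (f ` N x)" and ?b = "card (f ` N y)"
    note bx = card_image_N_bounds[OF f x] and by' = card_image_N_bounds[OF f yV]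
    \<comment> \<open>Since the images cover all colours, the complements have sizes with sum at
      most \<open>q\<close>.\<close>
    have ui: "?a + ?b = q + card (f ` N x \<inter> f ` N y)"
      using card_Un_Int[of "f ` N x" "f ` N y"] un finite_N[OF x] finite_N[OF yV] by simp
    let ?P = "(q - ?a) * (q - ?b)"
    have le: "?P \<le> balanced_product q" using ui bx by' by (intro mult_le_balanced_product) linarith
    have pos: "0 < ?P" using bx by' by simp
    have lP: "log 2 (real (q - ?a)) + log 2 (real (q - ?b)) = log 2 (real ?P)"
      using bx by' by (simp add: log_mult)
    show ?thesis
    proof (cases "ideal f x y")
      case True
      have "log 2 (real ?P) \<le> log 2 (real (balanced_product q))"
        using le pos by (intro log_mono) (auto simp del: of_nat_mult)
      then show ?thesis using lP False True by (simp add: eq)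
    next
      case nid: False
      have "?P \<noteq> balanced_product q"
      proof
        assume P: "?P = balanced_product q"
        have "(q - ?a) + (q - ?b) \<le> q" using ui bx by' by linarith
        from mult_eq_balanced_product_imp[OF this P q_ge_2] have s: "(q - ?a) + (q - ?b) = q" .
        then have ab: "?a + ?b = q" using bx by' by linarith
        then have "f ` N x \<inter> f ` N y = {}" using ui finite_N[OF x] by auto
        moreover have "q - ?a = ?b" "q - ?b = ?a" using ab by linarith+
        ultimately have "ideal f x y" using P by (simp add: ideal_def mult.commute)
        then show False using nid by simp
      qed
      then have "?P < balanced_product q" using le by simp
      from log2_gap[OF pos this]
      have "log 2 (real ?P) + 1 / real (balanced_product q) \<le> log 2 (real (balanced_product q))" .
      moreover have "1 / (real q)\<^sup>2 \<le> 1 / real (balanced_product q)"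
        using balanced_product_le_square[of q] balanced_product_pos[OF q_ge_2] q_ge_2
        by (intro divide_left_mono)
          (auto simp: power2_eq_square simp del: of_nat_mult simp flip: of_nat_mult)
      ultimately show ?thesis using lP False nid by (simp add: eq)
    qed
  qed
qed

text \<open>\<open>edge_log_le\<close> summed over all edges: each vertex lies in \<open>r\<close>
  of them, so the left sides add up to at least \<open>r\<close> times the entropy, and the main
  term cancels against the lower bound. Uncovered edges are traded for bad vertices by
  \<open>card_uncovered_le\<close>.\<close>

lemma nonideal_le_bad:
  assumes p: "\<And>x y. x \<in> V \<Longrightarrow> y \<in> N x \<Longrightarrow> card {f \<in> Col. \<not> ideal f x y} = p"
  shows "real p * real (card V) \<le> 12 * real q ^ 4 * (\<Sum>x\<in>V. real (card {f \<in> Col. bad f x}))"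
proof -
  define n where "n = real (card Col)"
  define \<eta> where "\<eta> = log 2 (real (balanced_product q))"
  define bc where "bc x = real (card {f \<in> Col. bad f x})" for x
  define g where "g x = (\<Sum>f\<in>Col. log 2 (real (q - card (f ` low x))))" for x
  have ind: "(\<Sum>f\<in>Col. of_bool (P f)) = real (card {f \<in> Col. P f})" for P
    using finite_Col by (simp add: Int_def)
  have edge: "g x + g y \<le> n * \<eta> - real p / (real q)\<^sup>2 + 3 * real q * (bc x + bc y + real q * bc x)"
    if x: "x \<in> V" and y: "y \<in> N x" for x y
  proof -
    let ?U = "real (card {f \<in> Col. f ` N x \<union> f ` N y \<noteq> {1..q}})"
    have "g x + g y \<le> (\<Sum>f\<in>Col. \<eta> - 1 / (real q)\<^sup>2 * of_bool (\<not> ideal f x y)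
      + 3 * real q * (of_bool (bad f x) + of_bool (bad f y) + of_bool (f ` N x \<union> f ` N y \<noteq> {1..q})))"
      unfolding g_def \<eta>_def sum.distrib[symmetric] by (intro sum_mono edge_log_le x y)
    also have "\<dots> = n * \<eta> - real p / (real q)\<^sup>2 + 3 * real q * (bc x + bc y + ?U)"
      unfolding sum.distrib sum_subtractf sum_distrib_left[symmetric] ind p[OF x y] bc_def n_def by simp
    also have "\<dots> \<le> n * \<eta> - real p / (real q)\<^sup>2 + 3 * real q * (bc x + bc y + real q * bc x)"
    proof -
      have "?U \<le> real q * bc x"
        unfolding bc_def of_nat_mult[symmetric] of_nat_le_iff by (rule card_uncovered_le[OF x y])
      then show ?thesis by (intro add_left_mono mult_left_mono) auto
    qed
    finally show ?thesis .
  qed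
  let ?E = "side True" and ?O = "side False"
  have sumV: "(\<Sum>x\<in>V. h x) = (\<Sum>x\<in>?E. h x) + (\<Sum>x\<in>?O. h x)" for h :: "'a \<Rightarrow> real"
    using sum.union_disjoint[OF finite_side[of True] finite_side[of False], of h]
      sides_disjoint[of True] V_eq_sides[of True] by simp
  have constN: "(\<Sum>y\<in>N x. h x) = real r * h x" if "x \<in> side b" for x b and h :: "'a \<Rightarrow> real"
    using card_N that side_sub by (auto simp: subset_iff)
  have swap: "(\<Sum>x\<in>?E. \<Sum>y\<in>N x. h y) = real r * (\<Sum>y\<in>?O. h y)" for h :: "'a \<Rightarrow> real"
    unfolding sum_edges_swap[of "\<lambda>x y. h y" True] not_True_eq_False sum_distrib_left
    by (intro sum.cong refl constN)
  have same: "(\<Sum>x\<in>?E. \<Sum>y\<in>N x. h x) = real r * (\<Sum>x\<in>?E. h x)" for h :: "'a \<Rightarrow> real"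
    unfolding sum_distrib_left by (intro sum.cong refl constN)
  have "real r * ent Col V \<le> real r * (\<Sum>x\<in>V. g x)"
    unfolding g_def by (intro mult_left_mono ent_V_le_low) simp
  also have "\<dots> = (\<Sum>x\<in>?E. \<Sum>y\<in>N x. g x + g y)"
    unfolding sum.distrib swap same sumV by (rule distrib_left)
  also have "\<dots> \<le> (\<Sum>x\<in>?E. \<Sum>y\<in>N x. n * \<eta> - real p / (real q)\<^sup>2
      + (3 * real q * (1 + real q) * bc x + 3 * real q * bc y))"
  proof (intro sum_mono)
    fix x y assume "x \<in> ?E" "y \<in> N x"
    then show "g x + g y \<le> n * \<eta> - real p / (real q)\<^sup>2 + (3 * real q * (1 + real q) * bc x + 3 * real q * bc y)"
      using edge[of x y] side_sub[of True] by (auto simp: algebra_simps subset_iff)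
  qed
  also have "\<dots> = real r * (real (card ?E) * (n * \<eta> - real p / (real q)\<^sup>2)
      + (3 * real q * (1 + real q) * (\<Sum>x\<in>?E. bc x) + 3 * real q * (\<Sum>y\<in>?O. bc y)))"
  proof -
    have "(\<Sum>x\<in>?E. \<Sum>y\<in>N x. c) = real r * (real (card ?E) * c)" for c :: real
      using same[of "\<lambda>_. c"] by simp
    moreover have "(\<Sum>x\<in>?E. \<Sum>y\<in>N x. c * bc x) = real r * (c * (\<Sum>x\<in>?E. bc x))" for c :: real
      unfolding same sum_distrib_left ..
    moreover have "(\<Sum>x\<in>?E. \<Sum>y\<in>N x. c * bc y) = real r * (c * (\<Sum>x\<in>?O. bc x))" for c :: real
      unfolding swap sum_distrib_left ..
    ultimately show ?thesis unfolding sum.distrib by (simp add: distrib_left)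
  qed
  finally have "ent Col V \<le> real (card ?E) * (n * \<eta> - real p / (real q)\<^sup>2)
      + (3 * real q * (1 + real q) * (\<Sum>x\<in>?E. bc x) + 3 * real q * (\<Sum>y\<in>?O. bc y))"
    using r_pos by (simp add: mult_le_cancel_left_pos)
  moreover have "real (card ?E) * (n * \<eta>) \<le> ent Col V"
  proof -
    have "n * (real (card ?E) * \<eta>) \<le> n * log 2 n"
      unfolding n_def \<eta>_def by (intro mult_left_mono log_card_Col_ge) auto
    then show ?thesis by (simp add: ent_V n_def algebra_simps)
  qed
  ultimately have "real (card ?E) * (real p / (real q)\<^sup>2)
     \<le> 3 * real q * (1 + real q) * (\<Sum>x\<in>?E. bc x) + 3 * real q * (\<Sum>y\<in>?O. bc y)"
    by (simp add: algebra_simps)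
  \<comment> \<open>Both coefficients are raised to \<open>6 * q * q\<close>, so that the two sides
    combine into a sum over \<open>V\<close>.\<close>
  also have "\<dots> \<le> 3 * real q * (2 * real q) * (\<Sum>x\<in>?E. bc x) + 3 * real q * (2 * real q) * (\<Sum>y\<in>?O. bc y)"
  proof (intro add_mono mult_right_mono mult_left_mono)
    show "3 * real q \<le> 3 * real q * (2 * real q)" using q_ge_2 by (simp add: mult_le_cancel_left1)
  qed (use q_ge_2 in \<open>auto simp: bc_def intro!: sum_nonneg\<close>)
  also have "\<dots> = 6 * (real q)\<^sup>2 * (\<Sum>x\<in>V. bc x)"
    unfolding sumV by (simp add: power2_eq_square algebra_simps)
  finally have "real (card ?E) * (real p / (real q)\<^sup>2) * (2 * (real q)\<^sup>2) \<le> 6 * (real q)\<^sup>2 * (\<Sum>x\<in>V. bc x) * (2 * (real q)\<^sup>2)"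
    by (rule mult_right_mono) simp
  moreover have "real (card ?E) * (real p / (real q)\<^sup>2) * (2 * (real q)\<^sup>2) = real p * real (card V)"
    using q_ge_2 card_V[of True] by simp
  moreover have "6 * (real q)\<^sup>2 * S * (2 * (real q)\<^sup>2) = 12 * real q ^ 4 * S" for S
    by (simp add: power2_eq_square power4_eq_xxxx)
  ultimately show ?thesis by (simp add: bc_def)
qed

section \<open>Ideal edges along walks and the combination of both bounds\<close>

text \<open>A maximal product forces the sizes to add up to \<open>q\<close>, so the two disjoint
  images are complementary.\<close>

lemma ideal_imp_complement:
  assumes f: "f \<in> Col" and x: "x \<in> V" and y: "y \<in> V" and id: "ideal f x y"
  shows "f ` N x = {1..q} - f ` N y" "f ` N y = {1..q} - f ` N x"
proof -
  have sub: "f ` N x \<subseteq> {1..q}" "f ` N y \<subseteq> {1..q}" using Col_image_sub[OF f] x y by auto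
  have dis: "f ` N x \<inter> f ` N y = {}" using id by (simp add: ideal_def)
  have c: "card (f ` N x \<union> f ` N y) = card (f ` N x) + card (f ` N y)"
    using dis finite_N[OF x] finite_N[OF y] by (intro card_Un_disjoint) auto
  moreover have "card (f ` N x \<union> f ` N y) \<le> card {1..q}" using sub by (intro card_mono) auto
  ultimately have "card (f ` N x) + card (f ` N y) = q"
    using id q_ge_2 by (intro mult_eq_balanced_product_imp) (auto simp: ideal_def)
  then have "f ` N x \<union> f ` N y = {1..q}" using c sub by (intro card_seteq) auto
  then show "f ` N x = {1..q} - f ` N y" "f ` N y = {1..q} - f ` N x" using dis by blast+
qed

text \<open>Two consecutive ideal edges complement the image twice and restore it. The bound is a
  union bound over the \<open>2 * k\<close> edges of the walk.\<close>

lemma card_change_along_walk: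
  assumes p: "\<And>x y. x \<in> V \<Longrightarrow> y \<in> N x \<Longrightarrow> card {f \<in> Col. \<not> ideal f x y} = p"
    and walk: "(x, y) \<in> {(x, y). x \<in> V \<and> y \<in> N x} ^^ (2 * k)"
  shows "card {f \<in> Col. f ` N x \<noteq> f ` N y} \<le> 2 * k * p"
  using walk
proof (induction k arbitrary: y)
  case 0
  then show ?case by simp
next
  case (Suc k)
  let ?R = "{(x, y). x \<in> V \<and> y \<in> N x}"
  have "(x, y) \<in> ?R ^^ Suc (Suc (2 * k))" using Suc.prems by simp
  then obtain u v where uv: "(x, u) \<in> ?R ^^ (2 * k)" "(u, v) \<in> ?R" "(v, y) \<in> ?R"
    by (meson relpow_Suc_E)
  then have V: "u \<in> V" "v \<in> V" "y \<in> V" "v \<in> N u" "y \<in> N v" using N_sub by auto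
  have "{f \<in> Col. f ` N x \<noteq> f ` N y} \<subseteq>
      {f \<in> Col. f ` N x \<noteq> f ` N u} \<union> ({f \<in> Col. \<not> ideal f u v} \<union> {f \<in> Col. \<not> ideal f v y})"
  proof (rule subsetI, rule ccontr)
    fix f
    assume f: "f \<in> {f \<in> Col. f ` N x \<noteq> f ` N y}"
      and "f \<notin> {f \<in> Col. f ` N x \<noteq> f ` N u} \<union> ({f \<in> Col. \<not> ideal f u v} \<union> {f \<in> Col. \<not> ideal f v y})"
    then have "f \<in> Col" "ideal f u v" "ideal f v y" "f ` N x = f ` N u" by simp_all
    then have "f ` N x = f ` N y"
      using ideal_imp_complement(1)[of f u v] ideal_imp_complement(2)[of f v y] V by simp
    then show False using f by simp
  qed
  then have "card {f \<in> Col. f ` N x \<noteq> f ` N y} \<le>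
      card ({f \<in> Col. f ` N x \<noteq> f ` N u} \<union> ({f \<in> Col. \<not> ideal f u v} \<union> {f \<in> Col. \<not> ideal f v y}))"
    using finite_Col by (intro card_mono) auto
  also have "\<dots> \<le> card {f \<in> Col. f ` N x \<noteq> f ` N u} + (card {f \<in> Col. \<not> ideal f u v} + card {f \<in> Col. \<not> ideal f v y})"
    by (meson add_left_mono card_Un_le order_trans)
  also have "\<dots> \<le> 2 * k * p + (p + p)"
    using Suc.IH[OF uv(1)] p V by simp
  finally show ?case by simp
qed

text \<open>\<open>sum_bad_side_le\<close> pays for bad vertices with non-ideal edges,
  \<open>nonideal_le_bad\<close> pays for non-ideal edges with bad vertices. By \<open>gain\<close>
  the combined factor is at most half of the saving \<open>s / q\<close> per bad vertex, so the
  feedback is absorbed and only the terms in \<open>\<epsilon>\<close> and \<open>V - W\<close>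
  survive.\<close>

lemma nonideal_count_le:
  fixes \<epsilon> :: real
  assumes p: "\<And>x y. x \<in> V \<Longrightarrow> y \<in> N x \<Longrightarrow> card {f \<in> Col. \<not> ideal f x y} = p"
    and W: "W \<subseteq> V"
    and s: "\<And>v. v \<in> W \<Longrightarrow> s \<le> card (low v)" "\<And>v. v \<in> W \<Longrightarrow> s \<le> card (upp v)" "s * q \<le> r"
    and \<epsilon>: "0 < \<epsilon>" "\<epsilon> \<le> 1/2"
    and walk: "\<And>v. v \<in> W \<Longrightarrow> \<exists>v'\<in>V. lev v' + 2 * m = lev v \<and>
        (v, v') \<in> {(x, y). x \<in> V \<and> y \<in> N x} ^^ (2 * m)"
    and gain: "2 * (log 2 (1 / \<epsilon>) + 2 * real q) * (1 + 24 * real m * real q ^ 4) \<le> real s / real q"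
  shows "real p * real (card V) \<le>
    12 * real q ^ 4 * (4 * \<epsilon> * real (card V) + 2 * real (card (V - W))) * real (card Col)"
proof -
  define \<Lambda> where "\<Lambda> = log 2 (1 / \<epsilon>) + 2 * real q"
  define \<Gamma> where "\<Gamma> = real s / real q"
  define n where "n = real (card Col)"
  \<comment> \<open>The \<open>2 * m\<close> edges of a walk times the factor
    \<open>12 * q ^ 4\<close> of \<open>nonideal_le_bad\<close>.\<close>
  define M where "M = 24 * real m * real q ^ 4"
  define bc where "bc v = real (card {f \<in> Col. bad f v})" for v
  define B where "B = (\<Sum>v\<in>W. bc v)"
  define \<alpha> where "\<alpha> = real (card (V - W))"
  define P where "P = real p * real (card V)"
  have M0: "0 \<le> M" by (simp add: M_def)
  have \<Lambda>2q: "2 * real q \<le> \<Lambda>" using \<epsilon> by (simp add: \<Lambda>_def)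
  have nn: "0 \<le> n" "0 \<le> \<alpha>" "0 \<le> B" by (auto simp: n_def \<alpha>_def B_def bc_def intro: sum_nonneg)
  have fW: "finite W" using W finite_V finite_subset by blast
  have gain': "2 * \<Lambda> * (1 + M) \<le> \<Gamma>" using gain by (simp add: \<Lambda>_def \<Gamma>_def M_def)
  have "2 * 1 * 1 \<le> 2 * \<Lambda> * (1 + M)" using \<Lambda>2q M0 q_ge_2 by (intro mult_mono) auto
  then have \<Gamma>2: "2 \<le> \<Gamma>" using gain' by linarith
  then have s0: "0 < s" by (cases s) (auto simp: \<Gamma>_def)
  have A: "\<Gamma> * (\<Sum>v\<in>side b \<inter> W. bc v) \<le> real (card (side b \<inter> W)) * (4 * \<epsilon> * n)
      + \<Lambda> * (2 * real m * real p * real (card (side b \<inter> W)) + (\<Sum>v\<in>side b \<inter> W. bc v))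
      + 2 * real q * real (card (side b - W)) * n" for b
    unfolding \<Gamma>_def \<Lambda>_def n_def bc_def
  proof (rule sum_bad_side_le[OF W s0 s \<epsilon>])
    fix v assume "v \<in> W"
    then obtain v' where v': "v' \<in> V" "lev v' + 2 * m = lev v"
        "(v, v') \<in> {(x, y). x \<in> V \<and> y \<in> N x} ^^ (2 * m)" using walk by blast
    have "card {f \<in> Col. f ` N v \<noteq> f ` N v'} \<le> 2 * m * p"
      by (rule card_change_along_walk[OF p v'(3)])
    then have "real (card {f \<in> Col. f ` N v \<noteq> f ` N v'}) \<le> 2 * real m * real p"
      using of_nat_mono[of _ "2 * m * p", where ?'a = real] by simp
    moreover have "even (lev v') \<longleftrightarrow> even (lev v)" unfolding v'(2)[symmetric] by simp
    ultimately show "\<exists>v'\<in>V. lev v' + 2 * m \<le> lev v \<and> (even (lev v') \<longleftrightarrow> even (lev v)) \<and>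
       real (card {f \<in> Col. f ` N v \<noteq> f ` N v'}) \<le> 2 * real m * real p"
      using v'(1,2) by (intro bexI[of _ v'] conjI) simp_all
  qed
  have "P \<le> 12 * real q ^ 4 * (\<Sum>x\<in>V. bc x)"
    unfolding P_def bc_def by (rule nonideal_le_bad[OF p])
  also have "(\<Sum>x\<in>V. bc x) = B + (\<Sum>x\<in>V - W. bc x)"
    unfolding B_def using sum.subset_diff[OF W finite_V, of bc] by simp
  also have "(\<Sum>x\<in>V - W. bc x) \<le> (\<Sum>x\<in>V - W. n)"
    unfolding bc_def n_def using finite_Col by (intro sum_mono) (auto intro: card_mono)
  also have "\<dots> = \<alpha> * n" by (simp add: \<alpha>_def)
  finally have P: "P \<le> 12 * real q ^ 4 * (B + \<alpha> * n)" by (simp add: mult_left_mono)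
  have W_split: "(\<Sum>v\<in>side True \<inter> W. h v) + (\<Sum>v\<in>side False \<inter> W. h v) = (\<Sum>v\<in>W. h v)" for h :: "'a \<Rightarrow> real"
    using W fW by (subst sum.union_disjoint[symmetric]) (auto intro!: sum.cong simp: side_def)
  have cW: "real (card (side True \<inter> W)) + real (card (side False \<inter> W)) = real (card W)"
    using W_split[of "\<lambda>_. 1"] by simp
  have c\<alpha>: "real (card (side True - W)) + real (card (side False - W)) = \<alpha>"
  proof -
    have "card (V - W) = card ((side True - W) \<union> (side False - W))"
      by (rule arg_cong[of _ _ card]) (auto simp: side_def)
    also have "\<dots> = card (side True - W) + card (side False - W)"
      by (rule card_Un_disjoint) (auto simp: finite_side, auto simp: side_def)
    finally show ?thesis by (simp add: \<alpha>_def)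
  qed
  have "\<Gamma> * B \<le> real (card W) * (4 * \<epsilon> * n) + \<Lambda> * (2 * real m * real p * real (card W) + B) + 2 * real q * \<alpha> * n"
    using add_mono[OF A[of True] A[of False]]
    unfolding B_def W_split[symmetric] cW[symmetric] c\<alpha>[symmetric] by (simp add: algebra_simps)
  also have "\<dots> \<le> real (card V) * (4 * \<epsilon> * n) + \<Lambda> * (2 * real m * P + B) + 2 * real q * \<alpha> * n"
  proof -
    have "real (card W) \<le> real (card V)" using card_mono[OF finite_V W] by simp
    then have "real p * real (card W) \<le> P" "real (card W) * (4 * \<epsilon> * n) \<le> real (card V) * (4 * \<epsilon> * n)"
      using \<epsilon> nn by (auto simp: P_def intro: mult_left_mono mult_right_mono)
    then have "2 * real m * (real p * real (card W)) + B \<le> 2 * real m * P + B"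
      by (intro add_right_mono mult_left_mono) auto
    then have "\<Lambda> * (2 * real m * (real p * real (card W)) + B) \<le> \<Lambda> * (2 * real m * P + B)"
      using \<Lambda>2q by (intro mult_left_mono) auto
    then show ?thesis using \<open>real (card W) * (4 * \<epsilon> * n) \<le> _\<close> by (simp add: mult.assoc)
  qed
  also have "\<dots> \<le> real (card V) * (4 * \<epsilon> * n) + \<Lambda> * (M * (B + \<alpha> * n) + B) + \<Lambda> * \<alpha> * n"
  proof -
    have "2 * real m * P \<le> 2 * real m * (12 * real q ^ 4 * (B + \<alpha> * n))"
      using P by (intro mult_left_mono) auto
    then have "2 * real m * P \<le> M * (B + \<alpha> * n)" by (simp add: M_def algebra_simps)
    then show ?thesis using \<Lambda>2q nn by (intro add_mono mult_left_mono mult_right_mono) auto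
  qed
  also have "\<dots> = real (card V) * (4 * \<epsilon> * n) + \<Lambda> * (1 + M) * (B + \<alpha> * n)"
    by (simp add: algebra_simps)
  also have "\<dots> \<le> real (card V) * (4 * \<epsilon> * n) + \<Gamma> / 2 * (B + \<alpha> * n)"
    using gain' nn by (intro add_left_mono mult_right_mono) auto
  finally have "\<Gamma> / 2 * (B - \<alpha> * n) \<le> real (card V) * (4 * \<epsilon> * n)"
    by (simp add: field_simps)
  \<comment> \<open>For a negative difference the bound \<open>BB\<close> is immediate.\<close>
  moreover have "B - \<alpha> * n \<le> \<Gamma> / 2 * (B - \<alpha> * n)" if "0 \<le> B - \<alpha> * n"
    using \<Gamma>2 that by (intro mult_le_cancel_right1[THEN iffD2]) auto
  moreover have "0 \<le> real (card V) * (4 * \<epsilon> * n)" using \<epsilon> nn by simp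
  ultimately have BB: "B \<le> real (card V) * (4 * \<epsilon> * n) + \<alpha> * n" by linarith
  have "P \<le> 12 * real q ^ 4 * (B + \<alpha> * n)" by (rule P)
  also have "\<dots> \<le> 12 * real q ^ 4 * (real (card V) * (4 * \<epsilon> * n) + \<alpha> * n + \<alpha> * n)"
    using BB by (intro mult_left_mono add_right_mono) auto
  also have "\<dots> = 12 * real q ^ 4 * (4 * \<epsilon> * real (card V) + 2 * \<alpha>) * n"
    by (simp add: algebra_simps)
  finally show ?thesis by (simp add: P_def \<alpha>_def n_def)
qed

end

section \<open>The even discrete torus\<close>

lemma verts_torus: "verts (torus m d) = {x. length x = d \<and> set x \<subseteq> {0..<m}}"
  by (simp add: torus_def)

lemma verts_torus_nth: "x \<in> verts (torus m d) \<longleftrightarrow> length x = d \<and> (\<forall>i<d. x ! i < m)"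
  by (auto simp: verts_torus in_set_conv_nth subset_iff)

lemma finite_verts_torus: "finite (verts (torus m d))"
  using finite_lists_length_eq[of "{0..<m}" d] by (simp add: verts_torus conj_commute)

lemma card_verts_torus: "card (verts (torus m d)) = m ^ d"
  using card_lists_length_eq[of "{0..<m}" d] by (simp add: verts_torus conj_commute)

lemma nbhd_torus_iff:
  assumes x: "x \<in> verts (torus m d)"
  shows "y \<in> nbhd (torus m d) x \<longleftrightarrow>
    (\<exists>i<d. \<exists>c<m. (x ! i = (c + 1) mod m \<or> c = (x ! i + 1) mod m) \<and> y = x[i := c])"
proof
  assume "y \<in> nbhd (torus m d) x"
  then obtain i where y: "y \<in> verts (torus m d)" and i: "i < d"
      "x ! i = (y ! i + 1) mod m \<or> y ! i = (x ! i + 1) mod m" "\<forall>j<d. j \<noteq> i \<longrightarrow> x ! j = y ! j"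
    by (auto simp: nbhd_def torus_def)
  have "y = x[i := y ! i]"
    using x y i(1,3) by (auto simp: verts_torus_nth nth_list_update intro!: nth_equalityI)
  then show "\<exists>i<d. \<exists>c<m. (x ! i = (c + 1) mod m \<or> c = (x ! i + 1) mod m) \<and> y = x[i := c]"
    using i(1,2) y by (auto simp: verts_torus_nth)
next
  assume "\<exists>i<d. \<exists>c<m. (x ! i = (c + 1) mod m \<or> c = (x ! i + 1) mod m) \<and> y = x[i := c]"
  then obtain i c where *: "i < d" "c < m" "x ! i = (c + 1) mod m \<or> c = (x ! i + 1) mod m" "y = x[i := c]"
    by blast
  then have "y \<in> verts (torus m d)" using x by (auto simp: verts_torus_nth nth_list_update)
  moreover have "adj (torus m d) x y" using * x by (auto simp: torus_def verts_torus_nth)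
  ultimately show "y \<in> nbhd (torus m d) x" by (simp add: nbhd_def)
qed

lemma nbhd_torus_sym:
  assumes "x \<in> verts (torus m d)" "y \<in> nbhd (torus m d) x"
  shows "x \<in> nbhd (torus m d) y"
  using assms by (auto simp: nbhd_def torus_def)

text \<open>Orients the edges: by \<open>nbhd_torus_cases\<close> every edge is such a step from one
  of its ends.\<close>

definition step_up :: "nat \<Rightarrow> nat \<Rightarrow> nat list \<Rightarrow> nat list" where
  "step_up m i x = x[i := (x ! i + 1) mod m]"

lemma step_up_in_nbhd:
  assumes "x \<in> verts (torus m d)" "i < d"
  shows "step_up m i x \<in> nbhd (torus m d) x"
proof -
  have "0 < m" using assms by (auto simp: verts_torus_nth)
  then show ?thesis unfolding nbhd_torus_iff[OF assms(1)] step_up_def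
    using assms(2) by (intro exI[of _ i] conjI exI[of _ "(x ! i + 1) mod m"]) auto
qed

lemma nbhd_torus_cases:
  assumes x: "x \<in> verts (torus m d)" and y: "y \<in> nbhd (torus m d) x"
  obtains i where "i < d" "y = step_up m i x" | i where "i < d" "x = step_up m i y"
proof -
  obtain i c where *: "i < d" "c < m" "x ! i = (c + 1) mod m \<or> c = (x ! i + 1) mod m" "y = x[i := c]"
    using y unfolding nbhd_torus_iff[OF x] by blast
  have "i < length x" using x * by (simp add: verts_torus_nth)
  show ?thesis
  proof (cases "c = (x ! i + 1) mod m")
    case True
    then show ?thesis using that(1)[of i] * by (simp add: step_up_def)
  next
    case False
    then have "x ! i = (c + 1) mod m" using * by simp
    then have "x = step_up m i y" using \<open>i < length x\<close> *(4)
      by (metis list_update_id list_update_overwrite nth_list_update_eq step_up_def)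
    then show ?thesis using that(2) * by blast
  qed
qed

lemma sum_list_step_up:
  assumes x: "x \<in> verts (torus m d)" and i: "i < d"
  shows "sum_list (step_up m i x) = sum_list x + 1 \<or> sum_list x = sum_list (step_up m i x) + (m - 1)"
proof -
  have l: "i < length x" "x ! i < m" using x i by (auto simp: verts_torus_nth)
  have mem: "x ! i \<le> sum_list x" using l by (simp add: member_le_sum_list)
  show ?thesis
  proof (cases "x ! i + 1 = m")
    case True
    then show ?thesis using l mem by (auto simp: step_up_def sum_list_update)
  next
    case False
    then have "(x ! i + 1) mod m = x ! i + 1" using l by simp
    then show ?thesis using l mem by (simp add: step_up_def sum_list_update)
  qed
qed

text \<open>An edge changes the coordinate sum by 1, or by \<open>m - 1\<close> if it wraps around;
  both are odd because \<open>m\<close> is even.\<close>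

lemma torus_level:
  assumes m: "even m" "2 \<le> m" and x: "x \<in> verts (torus m d)" and y: "y \<in> nbhd (torus m d) x"
  shows "even (sum_list y) \<noteq> even (sum_list x)" "sum_list y < sum_list x + m"
proof -
  have yV: "y \<in> verts (torus m d)" using y by (simp add: nbhd_def)
  have odd: "odd (m - 1)" using m by simp
  consider "sum_list y = sum_list x + 1" | "sum_list x = sum_list y + (m - 1)"
    | "sum_list x = sum_list y + 1" | "sum_list y = sum_list x + (m - 1)"
    using nbhd_torus_cases[OF x y] sum_list_step_up[OF x] sum_list_step_up[OF yV] by metis
  then show "even (sum_list y) \<noteq> even (sum_list x)" "sum_list y < sum_list x + m"
    using odd m(2) by (cases; simp)+
qed

section \<open>Edge transitivity and regularity\<close>

text \<open>The map is the transposition of coordinates \<open>i\<close> and \<open>i'\<close>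
  followed by a translation. Translations commute with increments, and the transposition only
  renames the incremented coordinate.\<close>

lemma torus_edge_automorphism:
  assumes x: "x \<in> verts (torus m d)" and x': "x' \<in> verts (torus m d)" and i: "i < d" and i': "i' < d"
  obtains \<phi> where "bij_betw \<phi> (verts (torus m d)) (verts (torus m d))"
    "\<And>z w. z \<in> verts (torus m d) \<Longrightarrow> w \<in> nbhd (torus m d) z \<Longrightarrow> \<phi> w \<in> nbhd (torus m d) (\<phi> z)"
    "\<phi> x = x'" "\<phi> (step_up m i x) = step_up m i' x'"
proof -
  let ?V = "verts (torus m d)"
  define \<tau> where "\<tau> = Transposition.transpose i i'"
  \<comment> \<open>The summand \<open>m\<close> prevents truncated subtraction and vanishes modulo
    \<open>m\<close>.\<close>
  define a where "a j = x' ! j + m - x ! (\<tau> j)" for j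
  define \<phi> where "\<phi> z = map (\<lambda>j. (z ! (\<tau> j) + a j) mod m) [0..<d]" for z
  have \<tau>d: "\<tau> j < d" if "j < d" for j using that i i' by (auto simp: \<tau>_def Transposition.transpose_def)
  have \<tau>\<tau>: "\<tau> (\<tau> j) = j" for j by (simp add: \<tau>_def)
  have \<tau>eq: "\<tau> j = k \<longleftrightarrow> j = \<tau> k" for j k using \<tau>\<tau> by metis
  have m0: "0 < m" using x i by (auto simp: verts_torus_nth)
  have len: "length (\<phi> z) = d" and nth: "j < d \<Longrightarrow> \<phi> z ! j = (z ! (\<tau> j) + a j) mod m" for z j
    by (simp_all add: \<phi>_def)
  have into: "\<phi> z \<in> ?V" for z using m0 by (simp add: verts_torus_nth len nth)
  have cancel: "u = v" if "(u + b) mod m = (v + b) mod m" "u < m" "v < m" for u v b :: nat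
  proof -
    have *: "u = v" if "u \<le> v" "(u + b) mod m = (v + b) mod m" "v < m" for u v :: nat
    proof -
      have "m dvd (v + b) - (u + b)" using that mod_eq_dvd_iff_nat[of "u + b" "v + b" m] by simp
      then have "m dvd v - u" by simp
      then show ?thesis using that by (auto dest: dvd_imp_le)
    qed
    then show ?thesis using that by (metis nat_le_linear)
  qed
  have inj: "inj_on \<phi> ?V"
  proof (rule inj_onI)
    fix z w assume z: "z \<in> ?V" and w: "w \<in> ?V" and eq: "\<phi> z = \<phi> w"
    have "z ! j = w ! j" if "j < d" for j
    proof -
      have "\<phi> z ! \<tau> j = \<phi> w ! \<tau> j" using eq by simp
      then show ?thesis using that z w by (auto simp: nth \<tau>d \<tau>\<tau> verts_torus_nth intro: cancel)
    qed
    then show "z = w" using z w by (auto simp: verts_torus_nth intro: nth_equalityI)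
  qed
  have bij: "bij_betw \<phi> ?V ?V"
    using inj into endo_inj_surj[OF finite_verts_torus, of \<phi> m d] by (auto simp: bij_betw_def)
  have step: "\<phi> (step_up m k z) = step_up m (\<tau> k) (\<phi> z)" if z: "z \<in> ?V" and k: "k < d" for z k
  proof (rule nth_equalityI)
    show "length (\<phi> (step_up m k z)) = length (step_up m (\<tau> k) (\<phi> z))" by (simp add: len step_up_def)
    fix j assume "j < length (\<phi> (step_up m k z))"
    then have j: "j < d" by (simp add: len)
    have "length z = d" using z by (simp add: verts_torus_nth)
    show "\<phi> (step_up m k z) ! j = step_up m (\<tau> k) (\<phi> z) ! j"
    proof (cases "j = \<tau> k")
      case True
      then have "\<tau> j = k" by (simp add: \<tau>\<tau>)
      then have "\<phi> (step_up m k z) ! j = ((z ! k + 1) mod m + a j) mod m"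
        using j k \<open>length z = d\<close> by (simp add: nth step_up_def)
      also have "\<dots> = ((z ! k + a j) mod m + 1) mod m" by (simp add: mod_simps algebra_simps)
      also have "\<dots> = step_up m (\<tau> k) (\<phi> z) ! j"
        using j True by (simp add: nth step_up_def len \<tau>\<tau>)
      finally show ?thesis .
    next
      case False
      then have "\<tau> j \<noteq> k" using \<tau>eq by blast
      then show ?thesis using False j by (simp add: nth step_up_def)
    qed
  qed
  have nb: "\<phi> w \<in> nbhd (torus m d) (\<phi> z)" if z: "z \<in> ?V" and w: "w \<in> nbhd (torus m d) z" for z w
    using z w
  proof (cases rule: nbhd_torus_cases)
    case (1 k)
    then show ?thesis using step[OF z] step_up_in_nbhd[OF into \<tau>d] by simp
  next
    case (2 k)
    have "w \<in> ?V" using w by (simp add: nbhd_def)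
    then have "\<phi> z \<in> nbhd (torus m d) (\<phi> w)" using 2 step step_up_in_nbhd[OF into \<tau>d] by simp
    then show ?thesis using nbhd_torus_sym[OF into] by blast
  qed
  have fx: "\<phi> x = x'"
  proof (rule nth_equalityI)
    show "length (\<phi> x) = length x'" using x' by (simp add: len verts_torus_nth)
    fix j assume "j < length (\<phi> x)"
    then have j: "j < d" by (simp add: len)
    have "x ! \<tau> j < m" "x' ! j < m" using x x' j \<tau>d by (auto simp: verts_torus_nth)
    then show "\<phi> x ! j = x' ! j" using j by (simp add: nth a_def)
  qed
  moreover have "\<phi> (step_up m i x) = step_up m i' x'"
    using step[OF x i] fx by (simp add: \<tau>_def)
  ultimately show ?thesis using that bij nb by blast
qed

text \<open>An automorphism embeds one neighbourhood in the other; exchanging \<open>x\<close> and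
  \<open>x'\<close> gives regularity.\<close>

lemma card_nbhd_torus_le:
  assumes x: "x \<in> verts (torus m d)" and x': "x' \<in> verts (torus m d)" and d: "0 < d"
  shows "card (nbhd (torus m d) x) \<le> card (nbhd (torus m d) x')"
proof -
  obtain \<phi> where \<phi>: "bij_betw \<phi> (verts (torus m d)) (verts (torus m d))"
    "\<And>z w. z \<in> verts (torus m d) \<Longrightarrow> w \<in> nbhd (torus m d) z \<Longrightarrow> \<phi> w \<in> nbhd (torus m d) (\<phi> z)"
    "\<phi> x = x'" using torus_edge_automorphism[OF x x' d d] by metis
  have "inj_on \<phi> (nbhd (torus m d) x)"
    using \<phi>(1) by (auto simp: bij_betw_def nbhd_def intro: inj_on_subset)
  moreover have "\<phi> ` nbhd (torus m d) x \<subseteq> nbhd (torus m d) x'" using \<phi>(2)[OF x] \<phi>(3) by blast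
  moreover have "finite (nbhd (torus m d) x')" using finite_verts_torus by (simp add: nbhd_def)
  ultimately show ?thesis by (rule card_inj_on_le)
qed

lemma step_up_inj:
  assumes x: "x \<in> verts (torus m d)" and m: "2 \<le> m"
  shows "inj_on (\<lambda>i. step_up m i x) {..<d}"
proof (rule inj_onI)
  fix i j assume ij: "i \<in> {..<d}" "j \<in> {..<d}" "step_up m i x = step_up m j x"
  have ne: "(x ! i + 1) mod m \<noteq> x ! i"
    using x ij m by (cases "x ! i + 1 = m") (auto simp: verts_torus_nth)
  show "i = j"
  proof (rule ccontr)
    assume "i \<noteq> j"
    then have "step_up m j x ! i = x ! i" by (simp add: step_up_def)
    moreover have "step_up m i x ! i = (x ! i + 1) mod m" using ij(1) x by (simp add: step_up_def verts_torus_nth)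
    ultimately show False using ij(3) ne by simp
  qed
qed

section \<open>Descending walks and strings with few coordinates of a given kind\<close>

text \<open>While the sum is positive some nonzero coordinate can be lowered by one, so no step
  wraps around.\<close>

lemma descending_walk:
  assumes "x \<in> verts (torus m d)" "k \<le> sum_list x"
  shows "\<exists>y\<in>verts (torus m d). sum_list y + k = sum_list x \<and>
    (x, y) \<in> {(x, y). x \<in> verts (torus m d) \<and> y \<in> nbhd (torus m d) x} ^^ k"
  using assms(2)
proof (induction k)
  case 0
  then show ?case using assms(1) by auto
next
  case (Suc k)
  then obtain y where y: "y \<in> verts (torus m d)" "sum_list y + k = sum_list x"
    "(x, y) \<in> {(x, y). x \<in> verts (torus m d) \<and> y \<in> nbhd (torus m d) x} ^^ k" by auto
  have "sum_list y \<noteq> 0" using y Suc.prems by linarith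
  then obtain a where "a \<in> set y" "a \<noteq> 0" by (auto simp: sum_list_eq_0_iff)
  then obtain i where i: "i < d" "y ! i \<noteq> 0" using y(1) by (auto simp: verts_torus_nth in_set_conv_nth)
  have l: "i < length y" "y ! i < m" using y(1) i by (auto simp: verts_torus_nth)
  let ?z = "y[i := y ! i - 1]"
  have "?z \<in> nbhd (torus m d) y" unfolding nbhd_torus_iff[OF y(1)]
    using i l by (intro exI[of _ i] conjI exI[of _ "y ! i - 1"]) auto
  moreover have "sum_list ?z + 1 = sum_list y"
    using i l member_le_sum_list[of "y ! i" y] by (simp add: sum_list_update)
  ultimately show ?case
    using y by (intro bexI[of _ ?z]) (auto simp: nbhd_def relpow.simps)
qed

lemma sum_lists_prod_list:
  fixes g :: "nat \<Rightarrow> real"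
  shows "(\<Sum>x\<in>verts (torus m d). prod_list (map g x)) = (\<Sum>a<m. g a) ^ d"
proof (induction d)
  case 0
  have "verts (torus m 0) = {[]}" by (auto simp: verts_torus)
  then show ?case by simp
next
  case (Suc d)
  have V: "verts (torus m (Suc d)) = (\<lambda>(a, x). a # x) ` ({..<m} \<times> verts (torus m d))"
    by (auto simp: verts_torus length_Suc_conv image_iff)
  have "inj_on (\<lambda>(a, x). a # x) ({..<m} \<times> verts (torus m d))" by (auto simp: inj_on_def)
  then have "(\<Sum>x\<in>verts (torus m (Suc d)). prod_list (map g x))
      = (\<Sum>(a, x)\<in>{..<m} \<times> verts (torus m d). g a * prod_list (map g x))"
    unfolding V by (subst sum.reindex) (auto intro!: sum.cong)
  also have "\<dots> = (\<Sum>a<m. g a) * (\<Sum>x\<in>verts (torus m d). prod_list (map g x))"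
    by (simp add: sum.cartesian_product[symmetric] sum_product)
  finally show ?case using Suc.IH by simp
qed

text \<open>Exponential Markov inequality: with weight 1/2 for each coordinate satisfying
  \<open>P\<close>, a counted string has weight at least \<open>1 / 2 ^ s\<close>, while all strings
  together have weight \<open>((m - 1) / 2 + 1) ^ d\<close>.\<close>

lemma card_few_filter_le:
  assumes P: "card {a. a < m \<and> P a} = m - 1" and m: "0 < m"
  shows "real (card {x \<in> verts (torus m d). length (filter P x) < s})
    \<le> 2 ^ s * ((real m + 1) / 2) ^ d"
proof -
  define g :: "nat \<Rightarrow> real" where "g a = (if P a then 1/2 else 1)" for a
  have g: "prod_list (map g x) = (1/2) ^ length (filter P x)" for x
    by (induction x) (auto simp: g_def)
  have "real (card {x \<in> verts (torus m d). length (filter P x) < s})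
     = (\<Sum>x | x \<in> verts (torus m d) \<and> length (filter P x) < s. 1)" by simp
  also have "\<dots> \<le> (\<Sum>x | x \<in> verts (torus m d) \<and> length (filter P x) < s. 2 ^ s * prod_list (map g x))"
  proof (rule sum_mono)
    fix x assume "x \<in> {x. x \<in> verts (torus m d) \<and> length (filter P x) < s}"
    then have "(2::real) ^ length (filter P x) \<le> 2 ^ s" by (intro power_increasing) auto
    then show "1 \<le> 2 ^ s * prod_list (map g x)" unfolding g by (simp add: power_divide field_simps)
  qed
  also have "\<dots> \<le> (\<Sum>x\<in>verts (torus m d). 2 ^ s * prod_list (map g x))"
    by (rule sum_mono2) (auto simp: finite_verts_torus g)
  also have "\<dots> = 2 ^ s * (\<Sum>a<m. g a) ^ d"
    by (simp add: sum_distrib_left[symmetric] sum_lists_prod_list)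
  also have "(\<Sum>a<m. g a) = (real m + 1) / 2"
  proof -
    have 1: "{..<m} \<inter> {a. P a} = {a. a < m \<and> P a}" by auto
    have "card ({..<m} \<inter> - {a. P a}) = m - card ({..<m} \<inter> {a. P a})"
      using card_Diff_subset_Int[of "{..<m}" "{a. P a}"] by (simp add: Diff_eq)
    then have "(\<Sum>a<m. g a) = real (m - 1) / 2 + real (m - (m - 1))"
      unfolding g_def by (simp add: sum.If_cases 1 P)
    then show ?thesis using m by (simp add: of_nat_diff field_simps)
  qed
  finally show ?thesis .
qed

section \<open>Maximal pairs of the complete graph\<close>

lemma verts_complete: "verts (complete_loopless_graph q) = {1..q}"
  by (simp add: complete_loopless_graph_def)

lemma fully_adj_complete:
  "fully_adj (complete_loopless_graph q) A B \<longleftrightarrow> A \<subseteq> {1..q} \<and> B \<subseteq> {1..q} \<and> A \<inter> B = {}"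
  by (auto simp: fully_adj_def complete_loopless_graph_def)

lemma eta_complete: "eta (complete_loopless_graph q) = balanced_product q"
  unfolding eta_def
proof (rule Max_eqI)
  let ?S = "{card A * card B | A B. fully_adj (complete_loopless_graph q) A B}"
  have le: "card A * card B \<le> balanced_product q" if "fully_adj (complete_loopless_graph q) A B" for A B
  proof -
    have AB: "A \<subseteq> {1..q}" "B \<subseteq> {1..q}" "A \<inter> B = {}" using that by (auto simp: fully_adj_complete)
    then have "finite A" "finite B" by (auto intro: finite_subset)
    then have "card A + card B = card (A \<union> B)" using AB by (simp add: card_Un_disjoint)
    also have "\<dots> \<le> card {1..q}" using AB by (intro card_mono) auto
    finally show ?thesis by (intro mult_le_balanced_product) simp
  qed
  then have "?S \<subseteq> {..balanced_product q}" by auto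
  then show "finite ?S" by (rule finite_subset) simp
  show "y \<le> balanced_product q" if "y \<in> ?S" for y using that le by auto
  have "fully_adj (complete_loopless_graph q) {1..q div 2} {q div 2 + 1..q}"
    by (auto simp: fully_adj_complete)
  moreover have "card {1..q div 2} * card {q div 2 + 1..q} = balanced_product q"
    by (simp add: balanced_product_def)
  ultimately show "balanced_product q \<in> ?S" by force
qed

lemma length_filter_le_sum_list: "length (filter (\<lambda>a. 1 \<le> a) x) \<le> sum_list (x :: nat list)"
  by (induction x) auto

section \<open>Colourings of the torus\<close>

locale torus_colouring =
  fixes m d q :: nat
  assumes even_m: "even m" and m_ge_2: "2 \<le> m" and d_pos: "0 < d" and q2: "2 \<le> q"
begin

abbreviation "V \<equiv> verts (torus m d)"
abbreviation "N \<equiv> nbhd (torus m d)"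

lemma zero_in_V: "replicate d 0 \<in> V"
  using m_ge_2 by (simp add: verts_torus_nth)

lemma d_le_degree: "d \<le> card (N x)" if "x \<in> V" for x
proof -
  have "card {..<d} \<le> card (N x)"
  proof (rule card_inj_on_le[OF step_up_inj[OF that m_ge_2]])
    show "(\<lambda>i. step_up m i x) ` {..<d} \<subseteq> N x" using step_up_in_nbhd[OF that] by auto
    show "finite (N x)" using finite_verts_torus by (simp add: nbhd_def)
  qed
  then show ?thesis by simp
qed

text \<open>Writing the degree as that of the zero string treats \<open>m = 2\<close>, where it is
  \<open>d\<close>, together with larger \<open>m\<close>, where it is \<open>2 d\<close>.\<close>

sublocale layered_colouring V N sum_list "card (N (replicate d 0))" m q
proof
  show "card (N x) = card (N (replicate d 0))" if "x \<in> V" for x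
    using card_nbhd_torus_le[OF that zero_in_V d_pos] card_nbhd_torus_le[OF zero_in_V that d_pos] by simp
  show "0 < card (N (replicate d 0))" using d_le_degree[OF zero_in_V] d_pos by simp
qed (use finite_verts_torus torus_level[OF even_m m_ge_2] nbhd_torus_sym q2 in \<open>auto simp: nbhd_def\<close>)

lemma Hom_eq_Col: "Hom (torus m d) (complete_loopless_graph q) = Col"
  unfolding Hom_def Col_def verts_complete nbhd_def
  by (auto simp: complete_loopless_graph_def)

lemma ideal_sym: "ideal f x y \<longleftrightarrow> ideal f y x"
  by (simp add: ideal_def Int_commute mult.commute)

text \<open>\<open>ideal\<close> is symmetric, so the end with even coordinate sum can take the role
  of \<open>u\<close>. Hence an edge that fails \<open>ideal_edge\<close> also fails
  \<open>ideal\<close>.\<close>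

lemma ideal_imp_ideal_edge:
  assumes f: "f \<in> Col" and x: "x \<in> V" and y: "y \<in> N x" and id: "ideal f x y"
  shows "ideal_edge m d (complete_loopless_graph q) f {x, y}"
proof -
  have yV: "y \<in> V" using y by (simp add: nbhd_def)
  have *: "ideal_edge m d (complete_loopless_graph q) f {u, v}"
    if "u \<in> V" "v \<in> V" "even (sum_list u)" "ideal f u v" for u v
  proof -
    have "(f ` N v, f ` N u) \<in> max_pairs (complete_loopless_graph q)"
      using that(4) Col_image_sub[OF f that(1)] Col_image_sub[OF f that(2)]
      by (auto simp: max_pairs_def fully_adj_complete eta_complete ideal_def mult.commute)
    moreover have "u \<in> even_verts m d" using that by (simp add: even_verts_def)
    ultimately show ?thesis unfolding ideal_edge_def by blast
  qed
  show ?thesis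
  proof (cases "even (sum_list x)")
    case True
    then show ?thesis using * x yV id by blast
  next
    case False
    then have "even (sum_list y)" using torus_level(1)[OF even_m m_ge_2 x y] by blast
    then show ?thesis using *[of y x] x yV id ideal_sym by (metis insert_commute)
  qed
qed

text \<open>Composition with an automorphism that carries one edge to the other injects the
  colourings in which the target is not ideal into those in which the source is not.\<close>

lemma card_nonideal_le:
  assumes x: "x \<in> V" and x': "x' \<in> V" and i: "i < d" "i' < d"
  shows "card {f \<in> Col. \<not> ideal f x' (step_up m i' x')} \<le> card {f \<in> Col. \<not> ideal f x (step_up m i x)}"
proof -
  obtain \<phi> where bij: "bij_betw \<phi> V V" and
    nb: "\<And>z w. z \<in> V \<Longrightarrow> w \<in> N z \<Longrightarrow> \<phi> w \<in> N (\<phi> z)" and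
    \<phi>: "\<phi> x = x'" "\<phi> (step_up m i x) = step_up m i' x'"
    using torus_edge_automorphism[OF x x' i] by metis
  have \<phi>V: "\<phi> z \<in> V" if "z \<in> V" for z using bij that by (auto simp: bij_betw_def)
  \<comment> \<open>The inclusion is an equality because the graph is regular and
    \<open>\<phi>\<close> is injective.\<close>
  have \<phi>N: "\<phi> ` N z = N (\<phi> z)" if z: "z \<in> V" for z
  proof (rule card_seteq)
    show "finite (N (\<phi> z))" using finite_N[OF \<phi>V[OF z]] .
    show "\<phi> ` N z \<subseteq> N (\<phi> z)" using nb[OF z] by blast
    have "inj_on \<phi> (N z)" using bij N_sub[OF z] by (auto simp: bij_betw_def intro: inj_on_subset)
    then show "card (N (\<phi> z)) \<le> card (\<phi> ` N z)" using card_N[OF z] card_N[OF \<phi>V[OF z]] by (simp add: card_image)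
  qed
  let ?\<Psi> = "\<lambda>f. restrict (f \<circ> \<phi>) V"
  have im: "?\<Psi> f ` N z = f ` N (\<phi> z)" if "z \<in> V" for f z
  proof -
    have "?\<Psi> f ` N z = (f \<circ> \<phi>) ` N z" using N_sub[OF that] by (intro image_cong) auto
    also have "\<dots> = f ` N (\<phi> z)" unfolding image_comp[symmetric] \<phi>N[OF that] ..
    finally show ?thesis .
  qed
  have "inj_on ?\<Psi> Col"
  proof (rule inj_onI)
    fix f g assume f: "f \<in> Col" and g: "g \<in> Col" and eq: "?\<Psi> f = ?\<Psi> g"
    have "f y = g y" if "y \<in> V" for y
    proof -
      obtain z where "z \<in> V" "y = \<phi> z" using bij \<open>y \<in> V\<close> by (auto simp: bij_betw_def)
      then show ?thesis using eq by (auto simp: restrict_eq_iff)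
    qed
    then show "f = g" using f g by (auto simp: Col_def intro: PiE_ext)
  qed
  then have "inj_on ?\<Psi> {f \<in> Col. \<not> ideal f x' (step_up m i' x')}" by (rule inj_on_subset) auto
  moreover have "?\<Psi> ` {f \<in> Col. \<not> ideal f x' (step_up m i' x')} \<subseteq> {f \<in> Col. \<not> ideal f x (step_up m i x)}"
  proof (rule image_subsetI)
    fix f assume f: "f \<in> {f \<in> Col. \<not> ideal f x' (step_up m i' x')}"
    have "?\<Psi> f z \<noteq> ?\<Psi> f w" if "z \<in> V" "w \<in> N z" for z w
      using f that nb[OF that] \<phi>V N_sub[OF that(1)] by (auto simp: Col_def subset_iff)
    moreover have "?\<Psi> f \<in> V \<rightarrow>\<^sub>E {1..q}" using f \<phi>V Col_range[of f] by auto
    ultimately have "?\<Psi> f \<in> Col" by (simp add: Col_def)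
    moreover have "step_up m i x \<in> V" using step_up_in_nbhd[OF x i(1)] N_sub[OF x] by blast
    ultimately show "?\<Psi> f \<in> {f \<in> Col. \<not> ideal f x (step_up m i x)}"
      using f im[OF x, of f] im[of "step_up m i x" f] \<phi> unfolding ideal_def by simp
  qed
  moreover have "finite {f \<in> Col. \<not> ideal f x (step_up m i x)}" using finite_Col by simp
  ultimately show ?thesis by (rule card_inj_on_le)
qed

lemma card_nonideal_edge:
  assumes x: "x \<in> V" and y: "y \<in> N x"
  shows "card {f \<in> Col. \<not> ideal f x y} =
    card {f \<in> Col. \<not> ideal f (replicate d 0) (step_up m 0 (replicate d 0))}"
proof -
  have yV: "y \<in> V" using y by (simp add: nbhd_def)
  from x y show ?thesis
  proof (cases rule: nbhd_torus_cases)
    case (1 i)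
    then show ?thesis
      using card_nonideal_le[OF x zero_in_V _ d_pos] card_nonideal_le[OF zero_in_V x d_pos] by (simp add: le_antisym)
  next
    case (2 i)
    have "card {f \<in> Col. \<not> ideal f y (step_up m i y)} =
        card {f \<in> Col. \<not> ideal f (replicate d 0) (step_up m 0 (replicate d 0))}"
      using card_nonideal_le[OF yV zero_in_V 2(1) d_pos] card_nonideal_le[OF zero_in_V yV d_pos 2(1)]
      by (rule le_antisym[rotated])
    then show ?thesis unfolding 2(2)[symmetric] ideal_sym[of _ x y] .
  qed
qed

text \<open>Lowering different positive coordinates gives different lower neighbours; wraparound may
  add more.\<close>

lemma card_low_ge:
  assumes x: "x \<in> V"
  shows "length (filter (\<lambda>a. 1 \<le> a) x) \<le> card (low x)"
proof -
  have len: "length x = d" and lt: "\<And>i. i < d \<Longrightarrow> x ! i < m" using x by (auto simp: verts_torus_nth)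
  let ?I = "{i. i < length x \<and> 1 \<le> x ! i}"
  have "card ?I \<le> card (low x)"
  proof (rule card_inj_on_le[where f = "\<lambda>i. x[i := x ! i - 1]"])
    show "inj_on (\<lambda>i. x[i := x ! i - 1]) ?I"
    proof (rule inj_onI, rule ccontr)
      fix i j assume *: "i \<in> ?I" "j \<in> ?I" "x[i := x ! i - 1] = x[j := x ! j - 1]" "i \<noteq> j"
      then have "x[i := x ! i - 1] ! i = x ! i" by simp
      then show False using *(1) by auto
    qed
    show "(\<lambda>i. x[i := x ! i - 1]) ` ?I \<subseteq> low x"
    proof (rule image_subsetI)
      fix i assume i: "i \<in> ?I"
      then have "x[i := x ! i - 1] \<in> N x" unfolding nbhd_torus_iff[OF x]
        using len lt[of i] by (intro exI[of _ i] conjI exI[of _ "x ! i - 1"]) auto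
      moreover have "sum_list (x[i := x ! i - 1]) < sum_list x"
        using i member_le_sum_list[of "x ! i" x] by (simp add: sum_list_update)
      ultimately show "x[i := x ! i - 1] \<in> low x" by (simp add: low_def)
    qed
    show "finite (low x)" using finite_subset[OF low_sub finite_N[OF x]] .
  qed
  then show ?thesis by (simp add: length_filter_conv_card)
qed

lemma card_upp_ge:
  assumes x: "x \<in> V"
  shows "length (filter (\<lambda>a. a + 1 < m) x) \<le> card (upp x)"
proof -
  have len: "length x = d" using x by (auto simp: verts_torus_nth)
  let ?I = "{i. i < length x \<and> x ! i + 1 < m}"
  have "card ?I \<le> card (upp x)"
  proof (rule card_inj_on_le[where f = "\<lambda>i. x[i := x ! i + 1]"])
    show "inj_on (\<lambda>i. x[i := x ! i + 1]) ?I"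
    proof (rule inj_onI, rule ccontr)
      fix i j assume *: "i \<in> ?I" "j \<in> ?I" "x[i := x ! i + 1] = x[j := x ! j + 1]" "i \<noteq> j"
      then have "x[i := x ! i + 1] ! i = x ! i" by simp
      then show False using *(1) by simp
    qed
    show "(\<lambda>i. x[i := x ! i + 1]) ` ?I \<subseteq> upp x"
    proof (rule image_subsetI)
      fix i assume i: "i \<in> ?I"
      then have "x[i := x ! i + 1] \<in> N x" unfolding nbhd_torus_iff[OF x]
        using len by (intro exI[of _ i] conjI exI[of _ "x ! i + 1"]) auto
      moreover have "\<not> sum_list (x[i := x ! i + 1]) < sum_list x"
        using i by (simp add: sum_list_update)
      ultimately show "x[i := x ! i + 1] \<in> upp x" by (simp add: low_def upp_def)
    qed
    show "finite (upp x)" using finite_subset[OF upp_sub finite_N[OF x]] .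
  qed
  then show ?thesis by (simp add: length_filter_conv_card)
qed

text \<open>\<open>W\<close> consists of the strings with at least \<open>s\<close> coordinates that
  can be lowered and at least \<open>s\<close> that can be raised without wraparound. Its complement
  is exponentially small, and \<open>2 * m \<le> s\<close> leaves room for a descending walk of
  length \<open>2 * m\<close>.\<close>

lemma prob_nonideal_le:
  assumes e: "e \<in> edges (torus m d)"
    and s: "2 * m \<le> s" "s * q \<le> d" and \<epsilon>: "0 < \<epsilon>" "\<epsilon> \<le> 1/2"
    and gain: "2 * (log 2 (1 / \<epsilon>) + 2 * real q) * (1 + 24 * real m * real q ^ 4) \<le> real s / real q"
  shows "\<P>(f in uniform_count_measure (Hom (torus m d) (complete_loopless_graph q)).
       \<not> ideal_edge m d (complete_loopless_graph q) f e)
    \<le> 12 * real q ^ 4 * (4 * \<epsilon> + 4 * 2 ^ s * (3/4) ^ d)"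
proof -
  obtain x y where xy: "e = {x, y}" "x \<in> V" "y \<in> N x"
    using e by (auto simp: edges_def nbhd_def)
  define p where "p = card {f \<in> Col. \<not> ideal f (replicate d 0) (step_up m 0 (replicate d 0))}"
  define L where "L = {x \<in> V. length (filter (\<lambda>a. 1 \<le> a) x) < s}"
  define U where "U = {x \<in> V. length (filter (\<lambda>a. a + 1 < m) x) < s}"
  define W where "W = V - (L \<union> U)"
  have n: "0 < real (card Col)" using log_card_Col_ge(1) finite_Col by (simp add: card_gt_0_iff)
  have "real p * real (card V) \<le>
    12 * real q ^ 4 * (4 * \<epsilon> * real (card V) + 2 * real (card (V - W))) * real (card Col)"
  proof (rule nonideal_count_le[OF _ _ _ _ _ \<epsilon> _ gain])
    show "card {f \<in> Col. \<not> ideal f x y} = p" if "x \<in> V" "y \<in> N x" for x y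
      unfolding p_def by (rule card_nonideal_edge[OF that])
    show "W \<subseteq> V" by (auto simp: W_def)
    show "s \<le> card (low v)" if "v \<in> W" for v
      using that card_low_ge[of v] by (auto simp: W_def L_def)
    show "s \<le> card (upp v)" if "v \<in> W" for v
      using that card_upp_ge[of v] by (auto simp: W_def U_def)
    show "s * q \<le> card (N (replicate d 0))" using s(2) d_le_degree[OF zero_in_V] by simp
    show "\<exists>v'\<in>V. sum_list v' + 2 * m = sum_list v \<and>
        (v, v') \<in> {(x, y). x \<in> V \<and> y \<in> N x} ^^ (2 * m)" if "v \<in> W" for v
    proof (rule descending_walk)
      show "v \<in> V" using that by (simp add: W_def)
      have "s \<le> length (filter (\<lambda>a. 1 \<le> a) v)" using that by (auto simp: W_def L_def)
      then show "2 * m \<le> sum_list v" using s(1) length_filter_le_sum_list[of v] by linarith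
    qed
  qed
  also have "\<dots> \<le> 12 * real q ^ 4 * (4 * \<epsilon> * real (card V) + 2 * (2 * (2 ^ s * (3/4) ^ d) * real (card V))) * real (card Col)"
  proof -
    have "{a. a < m \<and> 1 \<le> a} = {1..<m}" "{a. a < m \<and> a + 1 < m} = {..<m - 1}" by auto
    then have c: "card {a. a < m \<and> 1 \<le> a} = m - 1" "card {a. a < m \<and> a + 1 < m} = m - 1" by simp_all
    have "card (V - W) = card (L \<union> U)" by (rule arg_cong[of _ _ card]) (auto simp: W_def L_def U_def)
    also have "\<dots> \<le> card L + card U" by (rule card_Un_le)
    finally have "real (card (V - W)) \<le> real (card L) + real (card U)" by simp
    also have "\<dots> \<le> 2 ^ s * ((real m + 1) / 2) ^ d + 2 ^ s * ((real m + 1) / 2) ^ d"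
      unfolding L_def U_def using m_ge_2 by (intro add_mono card_few_filter_le c) auto
    also have "\<dots> \<le> 2 * (2 ^ s * (3/4 * real m) ^ d)"
    proof -
      \<comment> \<open>\<open>(m + 1) / 2 \<le> 3/4 * m\<close> is equivalent to
        \<open>m \<ge> 2\<close>; this makes the base independent of \<open>m\<close> after division
        by \<open>card V\<close>.\<close>
      have "((real m + 1) / 2) ^ d \<le> (3/4 * real m) ^ d" using m_ge_2 by (intro power_mono) auto
      then show ?thesis by simp
    qed
    also have "\<dots> = 2 * (2 ^ s * (3/4) ^ d) * real (card V)"
      unfolding card_verts_torus power_mult_distrib by simp
    finally show ?thesis by (intro mult_right_mono mult_left_mono add_left_mono) auto
  qed
  also have "\<dots> = (12 * real q ^ 4 * (4 * \<epsilon> + 4 * 2 ^ s * (3/4) ^ d) * real (card Col)) * real (card V)"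
    by (simp add: algebra_simps)
  finally have p: "real p \<le> 12 * real q ^ 4 * (4 * \<epsilon> + 4 * 2 ^ s * (3/4) ^ d) * real (card Col)"
    using m_ge_2 by (simp add: card_verts_torus)
  have "\<P>(f in uniform_count_measure (Hom (torus m d) (complete_loopless_graph q)).
       \<not> ideal_edge m d (complete_loopless_graph q) f e)
     = real (card {f \<in> Col. \<not> ideal_edge m d (complete_loopless_graph q) f e}) / real (card Col)"
    unfolding Hom_eq_Col
    by (subst measure_uniform_count_measure) (auto simp: finite_Col space_uniform_count_measure)
  also have "card {f \<in> Col. \<not> ideal_edge m d (complete_loopless_graph q) f e} \<le> card {f \<in> Col. \<not> ideal f x y}"
    using ideal_imp_ideal_edge[OF _ xy(2,3)] finite_Col unfolding xy(1) by (intro card_mono) auto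
  also have "\<dots> = p" unfolding p_def by (rule card_nonideal_edge[OF xy(2,3)])
  also have "real p / real (card Col) \<le> 12 * real q ^ 4 * (4 * \<epsilon> + 4 * 2 ^ s * (3/4) ^ d)"
    using p n by (simp add: pos_divide_le_eq)
  finally show ?thesis by (simp add: divide_right_mono)
qed

end

section \<open>Choice of parameters and asymptotics\<close>

theorem theorem5p1:
  fixes m :: nat
  assumes "even m" and "m \<ge> 2"
  shows "\<forall>\<^sub>F d :: nat in sequentially. \<forall>q :: nat.
           0 < q \<and> real q < log 2 (real d) / (real m + 2) \<longrightarrow>
           (\<forall>e \<in> edges (torus m d).
              \<P>(f in uniform_count_measure (Hom (torus m d) (complete_loopless_graph q)).
                 \<not> ideal_edge m d (complete_loopless_graph q) f e) \<le> 1 / real d ^ 4)"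
proof -
  \<comment> \<open>The parameters are \<open>\<epsilon> = 1 / d ^ 6\<close> and \<open>s\<close>,
    the ceiling of \<open>sqrt d\<close>. The four facts give \<open>2 * m \<le> s\<close>,
    \<open>s * q \<le> d\<close>, the gain condition and the final estimate, with
    \<open>log 2 d\<close> in place of \<open>q\<close>.\<close>
  have e1: "\<forall>\<^sub>F d :: nat in sequentially. 2 * real m \<le> sqrt (real d)"
    by real_asymp
  have e2: "\<forall>\<^sub>F d :: nat in sequentially. (sqrt (real d) + 1) * log 2 (real d) \<le> real d"
    by real_asymp
  \<comment> \<open>The factor \<open>8 * log 2 d\<close> bounds
    \<open>log 2 (d ^ 6) + 2 * q\<close>.\<close>
  have e3: "\<forall>\<^sub>F d :: nat in sequentially.
      2 * (8 * log 2 (real d)) * (1 + 24 * real m * log 2 (real d) ^ 4) * log 2 (real d) \<le> sqrt (real d)"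
    by real_asymp
  \<comment> \<open>The exponent 6 leaves a factor \<open>d ^ 2\<close> to absorb the power of the
    logarithm; \<open>(3/4) ^ d\<close> outweighs the power of 2.\<close>
  have e4: "\<forall>\<^sub>F d :: nat in sequentially. 12 * log 2 (real d) ^ 4 *
      (4 * (1 / real d ^ 6) + 4 * 2 powr (sqrt (real d) + 1) * (3/4) ^ d) \<le> 1 / real d ^ 4"
    by real_asymp
  show ?thesis
    using e1 e2 e3 e4 eventually_ge_at_top[of 2]
  proof eventually_elim
    case (elim d)
    define l where "l = log 2 (real d)"
    show ?case
    proof (intro allI impI ballI)
      fix q :: nat and e
      assume q: "0 < q \<and> real q < log 2 (real d) / (real m + 2)" and e: "e \<in> edges (torus m d)"
      have l0: "0 \<le> l" using elim(5) by (simp add: l_def)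
      have "l / (real m + 2) \<le> l / 1" using l0 by (intro divide_left_mono) auto
      then have ql: "real q \<le> l" using q by (simp add: l_def)
      show "\<P>(f in uniform_count_measure (Hom (torus m d) (complete_loopless_graph q)).
                 \<not> ideal_edge m d (complete_loopless_graph q) f e) \<le> 1 / real d ^ 4"
      proof (cases "q = 1")
        \<comment> \<open>With one colour an edge cannot be coloured properly; the space is empty
          and its measure is 0.\<close>
        case True
        have "Hom (torus m d) (complete_loopless_graph q) = {}"
        proof (rule ccontr)
          assume "Hom (torus m d) (complete_loopless_graph q) \<noteq> {}"
          then obtain f where f: "f \<in> Hom (torus m d) (complete_loopless_graph q)" by blast
          obtain u v where "u \<in> verts (torus m d)" "v \<in> verts (torus m d)" "adj (torus m d) u v"
            using e by (auto simp: edges_def)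
          then have "f u \<noteq> f v" "f u \<in> {1..q}" "f v \<in> {1..q}"
            using f by (auto simp: Hom_def complete_loopless_graph_def)
          then show False using True by simp
        qed
        then show ?thesis by (simp add: space_uniform_count_measure)
      next
        case False
        then interpret torus_colouring m d q
          using assms q elim(5) by unfold_locales auto
        define s where "s = nat \<lceil>sqrt (real d)\<rceil>"
        have s: "sqrt (real d) \<le> real s" "real s \<le> sqrt (real d) + 1"
          by (simp_all add: s_def)
        have "\<P>(f in uniform_count_measure (Hom (torus m d) (complete_loopless_graph q)).
                 \<not> ideal_edge m d (complete_loopless_graph q) f e)
            \<le> 12 * real q ^ 4 * (4 * (1 / real d ^ 6) + 4 * 2 ^ s * (3/4) ^ d)"
        proof (rule prob_nonideal_le[OF e])
          have "real (2 * m) \<le> real s" using elim(1) s(1) by simp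
          then show "2 * m \<le> s" by (simp only: of_nat_le_iff)
          have "real s * real q \<le> (sqrt (real d) + 1) * l" using s ql by (intro mult_mono) auto
          then have "real (s * q) \<le> real d" using elim(2) by (simp add: l_def)
          then show "s * q \<le> d" by (simp only: of_nat_le_iff)
          show "0 < 1 / real d ^ 6" using elim(5) by simp
          have "(2::real) ^ 1 \<le> real d ^ 6"
            using elim(5) power_mono[of 2 "real d" 6] by simp
          then show "1 / real d ^ 6 \<le> 1 / 2" using elim(5) by (intro divide_left_mono) auto
          have "log 2 (1 / (1 / real d ^ 6)) = 6 * l"
            using elim(5) by (simp add: l_def log_nat_power)
          then have "2 * (log 2 (1 / (1 / real d ^ 6)) + 2 * real q) * (1 + 24 * real m * real q ^ 4) * real q
              \<le> 2 * (8 * l) * (1 + 24 * real m * l ^ 4) * l"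
            using ql l0 by (intro mult_mono add_mono power_mono) auto
          also have "\<dots> \<le> real s" using elim(3) s(1) by (simp add: l_def)
          finally show "2 * (log 2 (1 / (1 / real d ^ 6)) + 2 * real q) * (1 + 24 * real m * real q ^ 4) \<le> real s / real q"
            using q by (simp add: pos_le_divide_eq)
        qed
        also have "\<dots> \<le> 12 * l ^ 4 * (4 * (1 / real d ^ 6) + 4 * 2 powr (sqrt (real d) + 1) * (3/4) ^ d)"
        proof -
          have "(2::real) ^ s \<le> 2 powr (sqrt (real d) + 1)"
            using s(2) by (simp add: powr_realpow[symmetric])
          then show ?thesis using ql l0 by (intro mult_mono add_mono power_mono) auto
        qed
        also have "\<dots> \<le> 1 / real d ^ 4" using elim(4) by (simp add: l_def)
        finally show ?thesis .
      qed
    qed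
  qed
qed

end
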